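(* Let $L,\rho,\mu,\beta,\alpha_1>0$, $\gamma\in\mathbb{R}$, $\alpha=\alpha_1+\gamma^2\beta$, and $$\eta=\max\left(\sqrt{\tfrac{\rho}{\alpha_1}}+\sqrt{\tfrac{\mu\gamma^2}{\alpha_1}},\ \sqrt{\tfrac{\mu}{\beta}}+\sqrt{\tfrac{\mu\gamma^2}{\alpha_1}}\right).$$ Let $\epsilon$ be any number such that $$\frac{\beta\gamma^2\mu}{4\alpha_1\beta\eta^2-\alpha\mu}<\epsilon<\frac{4\alpha_1\eta^2-\rho}{\rho},$$ and define the non-negative constants $$c_1^\pm=\frac{2\alpha_1\eta\pm\sqrt{4\alpha_1^2\eta^2-(1+\epsilon)\rho\alpha_1}}{1+\epsilon},\qquad c_2^\pm=\frac{2\epsilon\alpha_1\beta\eta\pm\sqrt{4(\epsilon\alpha_1\beta\eta)^2-(\epsilon\alpha+\beta\gamma^2)\epsilon\mu\alpha_1\beta}}{\epsilon\alpha+\beta\gamma^2}.$$ If $\xi_1\in(c_1^-,c_1^+)$ and $\xi_2\in(c_2^-,c_2^+)$, then the decay rate $-\sigma_{\max}$ with $\sigma_{\max}=\frac{1}{4\eta L}$ (the maximum of $\sigma(\delta)=\delta(1-\delta L\eta)$, attained at $\delta=\frac{1}{2\eta L}$) is achieved for the closed-loop system $$\rho v_{tt}-\alpha v_{xx}+\gamma\beta p_{xx}=0,\qquad \mu p_{tt}-\beta p_{xx}+\gamma\beta v_{xx}=0\qquad (0<x<L,\ t>0),$$ $$v(0,t)=p(0,t)=0,\quad \alpha v_x(L,t)-\gamma\beta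 p_x(L,t)=-\xi_1 v_t(L,t),\quad \beta p_x(L,t)-\gamma\beta v_x(L,t)=-\xi_2 p_t(L,t).$$ That is, every solution with initial data in $\mathcal{H}$ satisfies $$E(t)\le M\,E(0)\,e^{-\sigma_{\max}t}\quad\text{for all }t>0,$$ where $M=\frac{1+\delta L\eta}{1-\delta L\eta}$ with $\delta=\frac1{2\eta L}$, i.e. $M=3$.
   Context: All functions are real-valued. $H^1_*(0,L)=\{z\in H^1(0,L): z(0)=0\}$ and $\mathcal{H}=(H^1_*(0,L))^2\times(L^2(0,L))^2$. The energy of a solution is $$E(t)=\frac12\int_0^L\left[\rho|v_t|^2+\mu|p_t|^2+\alpha_1|v_x|^2+\beta|\gamma v_x-p_x|^2\right]dx.$$ A strong solution is a pair $(v,p)$ in $C([0,\infty);(H^2(0,L)\cap H^1_*(0,L))^2)\cap C^1([0,\infty);(H^1_*(0,L))^2)\cap C^2([0,\infty);(L^2(0,L))^2)$ satisfying the equations and boundary conditions. A solution with initial data $[v,p,v_t,p_t](\cdot,0)=[v_0,p_0,v_1,p_1]\in\mathcal{H}$ is the weak (semigroup) solution $(v,p,v_t,p_t)\in C([0,\infty);\mathcal{H})$, i.e. the limit in $C([0,T];\mathcal{H})$, for every $T>0$, of strong solutions. *)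

theory Defs
  imports "HOL-Analysis.Analysis"
begin

abbreviation interval_measure :: "real \<Rightarrow> real measure"
  where "interval_measure L \<equiv> lebesgue_on {0<..<L}"

text \<open>Elements of the function spaces over \<open>(0,L)\<close> are represented by functions; functions that
  agree almost everywhere on \<open>(0,L)\<close> represent the same element of \<open>L\<^sup>2(0,L)\<close>.\<close>

definition L2_space :: "real \<Rightarrow> (real \<Rightarrow> real) set" where
  "L2_space L = {z. z \<in> borel_measurable (interval_measure L) \<and>
                    integrable (interval_measure L) (\<lambda>x. (z x)\<^sup>2)}"

definition norm_L2 :: "real \<Rightarrow> (real \<Rightarrow> real) \<Rightarrow> real" where
  "norm_L2 L z = sqrt (\<integral>x. (z x)\<^sup>2 \<partial>interval_measure L)"

text \<open>Weak derivatives are tested against \<open>C\<^sup>1\<close> functions with compact support in \<open>(0,L)\<close>,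
  as in Brezis, Functional Analysis, Sobolev Spaces and Partial Differential Equations, Section 8.2.\<close>

definition test_functions :: "real \<Rightarrow> (real \<Rightarrow> real) set" where
  "test_functions L = {\<phi>. \<phi> C1_differentiable_on UNIV \<and> closure {x. \<phi> x \<noteq> 0} \<subseteq> {0<..<L}}"

definition is_weak_deriv :: "real \<Rightarrow> (real \<Rightarrow> real) \<Rightarrow> (real \<Rightarrow> real) \<Rightarrow> bool" where
  "is_weak_deriv L z g \<longleftrightarrow>
     (\<forall>\<phi>\<in>test_functions L.
        (\<integral>x. z x * deriv \<phi> x \<partial>interval_measure L) = - (\<integral>x. g x * \<phi> x \<partial>interval_measure L))"

text \<open>An element of \<open>H\<^sup>1(0,L)\<close> is always given by its representative that is continuous
  on \<open>[0,L]\<close>, so that \<open>z 0\<close> and \<open>z L\<close> are its boundary traces.\<close>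

definition H1_space :: "real \<Rightarrow> (real \<Rightarrow> real) set" where
  "H1_space L = {z \<in> L2_space L. continuous_on {0..L} z \<and> (\<exists>g\<in>L2_space L. is_weak_deriv L z g)}"

definition H1s_space :: "real \<Rightarrow> (real \<Rightarrow> real) set" where
  "H1s_space L = {z \<in> H1_space L. z 0 = 0}"

text \<open>The weak derivative is unique almost everywhere; its representative that is continuous
  on \<open>[0,L]\<close> is chosen whenever the derivative lies in \<open>H\<^sup>1(0,L)\<close>. Hence \<open>wderiv L z L\<close> is the
  trace of \<open>z\<^sub>x\<close> at \<open>L\<close> for \<open>z\<close> in \<open>H\<^sup>2(0,L)\<close>.\<close>

definition wderiv :: "real \<Rightarrow> (real \<Rightarrow> real) \<Rightarrow> real \<Rightarrow> real" where
  "wderiv L z = (SOME g. g \<in> L2_space L \<and> is_weak_deriv L z g \<and>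
                   ((\<exists>h\<in>H1_space L. is_weak_deriv L z h) \<longrightarrow> g \<in> H1_space L))"

definition H2_space :: "real \<Rightarrow> (real \<Rightarrow> real) set" where
  "H2_space L = {z \<in> H1_space L. \<exists>g\<in>H1_space L. is_weak_deriv L z g}"

definition norm_H1 :: "real \<Rightarrow> (real \<Rightarrow> real) \<Rightarrow> real" where
  "norm_H1 L z = sqrt ((norm_L2 L z)\<^sup>2 + (norm_L2 L (wderiv L z))\<^sup>2)"

definition norm_H2 :: "real \<Rightarrow> (real \<Rightarrow> real) \<Rightarrow> real" where
  "norm_H2 L z = sqrt ((norm_L2 L z)\<^sup>2 + (norm_L2 L (wderiv L z))\<^sup>2
                       + (norm_L2 L (wderiv L (wderiv L z)))\<^sup>2)"

text \<open>\<open>C0_path X N u\<close> says that \<open>u\<close> belongs to \<open>C([0,\<infinity>);X)\<close>, where \<open>X\<close> carries the norm \<open>N\<close>;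
  \<open>C1_path X N u u'\<close> says that \<open>u\<close> belongs to \<open>C\<^sup>1([0,\<infinity>);X)\<close> with derivative \<open>u'\<close>
  (one-sided at \<open>0\<close>).\<close>

definition C0_path :: "'a::minus set \<Rightarrow> ('a \<Rightarrow> real) \<Rightarrow> (real \<Rightarrow> 'a) \<Rightarrow> bool" where
  "C0_path X N u \<longleftrightarrow>
     (\<forall>t\<ge>0. u t \<in> X \<and> ((\<lambda>s. N (u s - u t)) \<longlongrightarrow> 0) (at t within {0..}))"

definition C1_path ::
  "(real \<Rightarrow> real) set \<Rightarrow> ((real \<Rightarrow> real) \<Rightarrow> real) \<Rightarrow> (real \<Rightarrow> real \<Rightarrow> real) \<Rightarrow> (real \<Rightarrow> real \<Rightarrow> real) \<Rightarrow> bool"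
  where
  "C1_path X N u u' \<longleftrightarrow> C0_path X N u \<and> C0_path X N u' \<and>
     (\<forall>t\<ge>0. ((\<lambda>s. N (\<lambda>x. (u s x - u t x) / (s - t) - u' t x)) \<longlongrightarrow> 0) (at t within {0..}))"

text \<open>Strong solutions \<open>(v,p)\<close> of the closed-loop system, together with their velocities
  \<open>vt = v\<^sub>t\<close> and \<open>pt = p\<^sub>t\<close>. The first argument of each function is time, the second is space.\<close>

definition strong_solution ::
  "real \<Rightarrow> real \<Rightarrow> real \<Rightarrow> real \<Rightarrow> real \<Rightarrow> real \<Rightarrow> real \<Rightarrow> real \<Rightarrow>
   (real \<Rightarrow> real \<Rightarrow> real) \<Rightarrow> (real \<Rightarrow> real \<Rightarrow> real) \<Rightarrow>
   (real \<Rightarrow> real \<Rightarrow> real) \<Rightarrow> (real \<Rightarrow> real \<Rightarrow> real) \<Rightarrow> bool" where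
  "strong_solution L \<rho> \<mu> \<alpha>1 \<beta> \<gamma> \<xi>1 \<xi>2 v p vt pt \<longleftrightarrow>
    (let \<alpha> = \<alpha>1 + \<gamma>\<^sup>2 * \<beta> in
     C0_path (H2_space L \<inter> H1s_space L) (norm_H2 L) v \<and>
     C0_path (H2_space L \<inter> H1s_space L) (norm_H2 L) p \<and>
     C1_path (H1s_space L) (norm_H1 L) v vt \<and>
     C1_path (H1s_space L) (norm_H1 L) p pt \<and>
     (\<exists>vtt ptt.
        C1_path (L2_space L) (norm_L2 L) v vt \<and> C1_path (L2_space L) (norm_L2 L) vt vtt \<and>
        C1_path (L2_space L) (norm_L2 L) p pt \<and> C1_path (L2_space L) (norm_L2 L) pt ptt \<and>
        (\<forall>t>0. AE x in interval_measure L.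
           \<rho> * vtt t x - \<alpha> * wderiv L (wderiv L (v t)) x
             + \<gamma> * \<beta> * wderiv L (wderiv L (p t)) x = 0 \<and>
           \<mu> * ptt t x - \<beta> * wderiv L (wderiv L (p t)) x
             + \<gamma> * \<beta> * wderiv L (wderiv L (v t)) x = 0)) \<and>
     (\<forall>t>0. v t 0 = 0 \<and> p t 0 = 0 \<and>
        \<alpha> * wderiv L (v t) L - \<gamma> * \<beta> * wderiv L (p t) L = - \<xi>1 * vt t L \<and>
        \<beta> * wderiv L (p t) L - \<gamma> * \<beta> * wderiv L (v t) L = - \<xi>2 * pt t L))"

text \<open>A state is a quadruple \<open>(v, p, v\<^sub>t, p\<^sub>t)\<close> of functions of the space variable.\<close>

type_synonym state = "(real \<Rightarrow> real) \<times> (real \<Rightarrow> real) \<times> (real \<Rightarrow> real) \<times> (real \<Rightarrow> real)"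

definition state_space :: "real \<Rightarrow> state set" where
  "state_space L = H1s_space L \<times> H1s_space L \<times> L2_space L \<times> L2_space L"

fun state_norm :: "real \<Rightarrow> state \<Rightarrow> real" where
  "state_norm L (v, p, w, q) =
     sqrt ((norm_H1 L v)\<^sup>2 + (norm_H1 L p)\<^sup>2 + (norm_L2 L w)\<^sup>2 + (norm_L2 L q)\<^sup>2)"

text \<open>The solution with initial data \<open>U0\<close>: a path that, on every \<open>[0,T]\<close>, is a limit
  of strong solutions in the norm of \<open>C([0,T])\<close> with values in the state space. The initial
  condition is an equality in the state space, i.e. up to null sets.\<close>

definition weak_solution ::
  "real \<Rightarrow> real \<Rightarrow> real \<Rightarrow> real \<Rightarrow> real \<Rightarrow> real \<Rightarrow> real \<Rightarrow> real \<Rightarrow> state \<Rightarrow> (real \<Rightarrow> state) \<Rightarrow> bool" where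
  "weak_solution L \<rho> \<mu> \<alpha>1 \<beta> \<gamma> \<xi>1 \<xi>2 U0 U \<longleftrightarrow>
     C0_path (state_space L) (state_norm L) U \<and>
     state_norm L (U 0 - U0) = 0 \<and>
     (\<forall>T>0. \<exists>v p vt pt.
        (\<forall>n::nat. strong_solution L \<rho> \<mu> \<alpha>1 \<beta> \<gamma> \<xi>1 \<xi>2 (v n) (p n) (vt n) (pt n)) \<and>
        uniform_limit {0..T}
          (\<lambda>n t. state_norm L ((v n t, p n t, vt n t, pt n t) - U t)) (\<lambda>t. 0) sequentially)"

fun energy :: "real \<Rightarrow> real \<Rightarrow> real \<Rightarrow> real \<Rightarrow> real \<Rightarrow> real \<Rightarrow> state \<Rightarrow> real" where
  "energy L \<rho> \<mu> \<alpha>1 \<beta> \<gamma> (v, p, w, q) =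
     1 / 2 * (\<integral>x. \<rho> * (w x)\<^sup>2 + \<mu> * (q x)\<^sup>2 + \<alpha>1 * (wderiv L v x)\<^sup>2
                    + \<beta> * (\<gamma> * wderiv L v x - wderiv L p x)\<^sup>2 \<partial>interval_measure L)"

end

theory Submission
  imports Defs "HOL-Real_Asymp.Real_Asymp"
begin

text \<open>For a strong solution let \<open>F = \<integral> x (\<rho> v\<^sub>t v\<^sub>x + \<mu> p\<^sub>t p\<^sub>x) dx\<close>. Integration by parts gives
  \<open>E' = -\<xi>\<^sub>1 v\<^sub>t(L)\<^sup>2 - \<xi>\<^sub>2 p\<^sub>t(L)\<^sup>2\<close> and \<open>F' = L/2 * X - E\<close>, where \<open>X\<close> is a quadratic form in the traces at \<open>L\<close>.
  With the boundary conditions and Young's inequality with parameter \<open>\<epsilon>\<close>, the bound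
  \<open>X \<le> -4 \<eta> E'\<close> splits into one quadratic inequality for each of \<open>\<xi>\<^sub>1\<close> and \<open>\<xi>\<^sub>2\<close>, whose roots are \<open>c\<^sub>1\<^sup>\<plusminus>\<close> and \<open>c\<^sub>2\<^sup>\<plusminus>\<close>.
  Hence \<open>V = E + \<delta> F\<close> satisfies \<open>V' \<le> -\<delta> E\<close>; since \<open>\<bar>F\<bar> \<le> L \<eta> E\<close> and \<open>\<delta> L \<eta> = 1/2\<close>, \<open>V\<close> lies between
  \<open>E/2\<close> and \<open>3E/2\<close>, which yields the decay with constant 3. Both sides of the estimate are continuous
  in the state norm, so it passes to weak solutions.\<close>

subsection \<open>Square-integrable functions on an interval\<close>

text \<open>The value of \<delta> and the factor 4 in the bound on X belong together: the boundary
  terms of V' are E' + \<delta> (L/2) X, and \<delta> (L/2) 4 \<eta> = 1 makes their sum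
  non-positive. What is left is -\<delta> E. With V \<le> (1 + \<delta> L \<eta>) E this gives the
  rate \<delta> / (1 + \<delta> L \<eta>), which is at least \<sigma>(\<delta>) = \<delta> (1 -
  \<delta> L \<eta>); the constant 3 is the quotient of 3/2 and 1/2. The work lies in the low
  regularity. In time, v_t and v_x are differentiable as paths in L2, so E and F are written as
  weighted L2 pairings and differentiated by a product rule for such pairings. In space,
  \<open>wderiv\<close> is a choice from a class modulo null sets, so its linearity holds almost
  everywhere and the exchange of time and space derivatives is a statement about norms. Integration
  by parts rests on the integral representation of H1 functions, which has to be extracted from the
  weak definition.\<close>

lemma finite_interval_measure: "finite_measure (interval_measure L)"
  by (rule finite_measure_lebesgue_on) simp

lemma integrable_mult_L2:
  assumes "a \<in> L2_space L" "b \<in> L2_space L"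
  shows "integrable (interval_measure L) (\<lambda>x. a x * b x)"
proof (rule Bochner_Integration.integrable_bound)
  show "integrable (interval_measure L) (\<lambda>x. (a x)\<^sup>2 + (b x)\<^sup>2)"
    using assms by (simp add: L2_space_def)
  show "(\<lambda>x. a x * b x) \<in> borel_measurable (interval_measure L)"
    using assms by (auto simp: L2_space_def)
  have "\<bar>u * v\<bar> \<le> u\<^sup>2 + v\<^sup>2" for u v :: real
    using zero_le_power2[of "u + v"] zero_le_power2[of "u - v"] zero_le_power2[of u] zero_le_power2[of v]
    unfolding power2_sum power2_diff by linarith
  then show "AE x in interval_measure L. norm (a x * b x) \<le> norm ((a x)\<^sup>2 + (b x)\<^sup>2)"
    by auto
qed

lemma L2_space_lincomb:
  assumes "a \<in> L2_space L" "b \<in> L2_space L"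
  shows "(\<lambda>x. c * a x + d * b x) \<in> L2_space L"
proof -
  have "integrable (interval_measure L) (\<lambda>x. c\<^sup>2 * (a x)\<^sup>2 + d\<^sup>2 * (b x)\<^sup>2 + (2 * c * d) * (a x * b x))"
    using assms integrable_mult_L2[OF assms] by (simp add: L2_space_def)
  moreover have "(c * a x + d * b x)\<^sup>2 = c\<^sup>2 * (a x)\<^sup>2 + d\<^sup>2 * (b x)\<^sup>2 + (2 * c * d) * (a x * b x)" for x
    by (simp add: power2_eq_square algebra_simps)
  moreover have "(\<lambda>x. c * a x + d * b x) \<in> borel_measurable (interval_measure L)"
    using assms by (auto simp: L2_space_def)
  ultimately show ?thesis
    by (simp add: L2_space_def)
qed

lemma L2_space_diff: "a \<in> L2_space L \<Longrightarrow> b \<in> L2_space L \<Longrightarrow> (\<lambda>x. a x - b x) \<in> L2_space L"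
  using L2_space_lincomb[of a L b 1 "-1"] by simp

lemma L2_space_quotient:
  "a \<in> L2_space L \<Longrightarrow> b \<in> L2_space L \<Longrightarrow> (\<lambda>x. (a x - b x) / h) \<in> L2_space L"
  using L2_space_lincomb[of a L b "1/h" "-1/h"] by (simp add: diff_divide_distrib)

lemma continuous_imp_bounded_Icc:
  fixes w :: "real \<Rightarrow> real"
  assumes "continuous_on {0..L} w"
  obtains K where "K > 0" "\<And>x. x \<in> {0..L} \<Longrightarrow> \<bar>w x\<bar> \<le> K"
proof -
  have "bounded (w ` {0..L})"
    using assms compact_continuous_image compact_imp_bounded compact_Icc by blast
  then show ?thesis
    using that by (auto simp: bounded_pos)
qed

lemma continuous_borel_measurable_interval:
  assumes "continuous_on {0..L} (w :: real \<Rightarrow> real)"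
  shows "w \<in> borel_measurable (interval_measure L)"
  by (rule continuous_imp_measurable_on_sets_lebesgue)
     (auto intro: continuous_on_subset[OF assms])

lemma L2_space_mult_continuous:
  assumes w: "continuous_on {0..L} (w :: real \<Rightarrow> real)" and a: "a \<in> L2_space L"
  shows "(\<lambda>x. w x * a x) \<in> L2_space L"
proof -
  obtain K where K: "K > 0" "\<And>x. x \<in> {0..L} \<Longrightarrow> \<bar>w x\<bar> \<le> K"
    using continuous_imp_bounded_Icc[OF w] by blast
  have m: "(\<lambda>x. w x * a x) \<in> borel_measurable (interval_measure L)"
    using continuous_borel_measurable_interval[OF w] a by (auto simp: L2_space_def)
  moreover have "integrable (interval_measure L) (\<lambda>x. (w x * a x)\<^sup>2)"
  proof (rule Bochner_Integration.integrable_bound)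
    show "integrable (interval_measure L) (\<lambda>x. K\<^sup>2 * (a x)\<^sup>2)"
      using a by (simp add: L2_space_def)
    show "(\<lambda>x. (w x * a x)\<^sup>2) \<in> borel_measurable (interval_measure L)"
      using m by auto
    have "(w x * a x)\<^sup>2 \<le> K\<^sup>2 * (a x)\<^sup>2" if "x \<in> {0<..<L}" for x
      using K(2)[of x] that power_mono[of "\<bar>w x\<bar>" K 2]
      by (auto simp: power_mult_distrib intro!: mult_right_mono)
    then show "AE x in interval_measure L. norm ((w x * a x)\<^sup>2) \<le> norm (K\<^sup>2 * (a x)\<^sup>2)"
      by (auto intro!: AE_I2)
  qed
  ultimately show ?thesis by (simp add: L2_space_def)
qed

lemma L2_space_const: "(\<lambda>x. c) \<in> L2_space L"
  unfolding L2_space_def using finite_measure.integrable_const[OF finite_interval_measure, of L "c\<^sup>2"]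
  by auto

lemma continuous_imp_L2_space:
  "continuous_on {0..L} w \<Longrightarrow> w \<in> L2_space L"
  using L2_space_mult_continuous[OF _ L2_space_const[of 1]] by simp

lemma L2_space_imp_integrable: "a \<in> L2_space L \<Longrightarrow> integrable (interval_measure L) a"
  using integrable_mult_L2[OF _ L2_space_const[of 1]] by simp

lemma norm_L2_cong_AE:
  assumes "a \<in> borel_measurable (interval_measure L)" "b \<in> borel_measurable (interval_measure L)"
    and "AE x in interval_measure L. a x = b x"
  shows "norm_L2 L a = norm_L2 L b"
proof -
  have "(\<integral>x. (a x)\<^sup>2 \<partial>interval_measure L) = (\<integral>x. (b x)\<^sup>2 \<partial>interval_measure L)"
    using assms by (intro integral_cong_AE) auto
  then show ?thesis by (simp add: norm_L2_def)
qed

lemma norm_L2_nonneg [simp]: "norm_L2 L a \<ge> 0"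
  by (simp add: norm_L2_def)

text \<open>The weight 1 yields the terms of the energy and the weight x those of the multiplier F.
  With the weight as a parameter, the bounds, limits and time derivatives are proved once for
  both.\<close>

definition ip :: "real \<Rightarrow> (real \<Rightarrow> real) \<Rightarrow> (real \<Rightarrow> real) \<Rightarrow> (real \<Rightarrow> real) \<Rightarrow> real" where
  "ip L w a b = (\<integral>x. w x * (a x * b x) \<partial>interval_measure L)"

lemma integrable_ip:
  assumes "continuous_on {0..L} w" "a \<in> L2_space L" "b \<in> L2_space L"
  shows "integrable (interval_measure L) (\<lambda>x. w x * (a x * b x))"
  using integrable_mult_L2[OF L2_space_mult_continuous[OF assms(1,2)] assms(3)]
  by (simp add: mult.assoc)

lemma ip_commute: "ip L w a b = ip L w b a"
  by (simp add: ip_def mult.commute)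

lemma ip_lincomb_left:
  assumes "continuous_on {0..L} w" "a \<in> L2_space L" "a' \<in> L2_space L" "b \<in> L2_space L"
  shows "ip L w (\<lambda>x. c * a x + d * a' x) b = c * ip L w a b + d * ip L w a' b"
proof -
  have "ip L w (\<lambda>x. c * a x + d * a' x) b =
      (\<integral>x. c * (w x * (a x * b x)) + d * (w x * (a' x * b x)) \<partial>interval_measure L)"
    unfolding ip_def by (rule arg_cong[where f = "integral\<^sup>L _"]) (simp add: fun_eq_iff algebra_simps)
  then show ?thesis
    using integrable_ip[OF assms(1,2,4)] integrable_ip[OF assms(1,3,4)] by (simp add: ip_def)
qed

lemma ip_diff_left:
  assumes "continuous_on {0..L} w" "a \<in> L2_space L" "a' \<in> L2_space L" "b \<in> L2_space L"
  shows "ip L w (\<lambda>x. a x - a' x) b = ip L w a b - ip L w a' b"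
  using ip_lincomb_left[OF assms, of 1 "-1"] by simp

lemma ip_diff_right:
  assumes "continuous_on {0..L} w" "a \<in> L2_space L" "b \<in> L2_space L" "b' \<in> L2_space L"
  shows "ip L w a (\<lambda>x. b x - b' x) = ip L w a b - ip L w a b'"
  using ip_diff_left[OF assms(1,3,4,2)] by (simp add: ip_commute)

text \<open>The integral of (s |a| - r |b|)^2 is a non-negative quadratic form in s and r, so its
  discriminant has the right sign. The absolute value stands inside the integral because a bounded
  weight is inserted there afterwards.\<close>

lemma Cauchy_Schwarz_L2:
  assumes a: "a \<in> L2_space L" and b: "b \<in> L2_space L"
  shows "(\<integral>x. \<bar>a x * b x\<bar> \<partial>interval_measure L) \<le> norm_L2 L a * norm_L2 L b"
proof -
  let ?M = "interval_measure L"
  define A where "A = (\<integral>x. (a x)\<^sup>2 \<partial>?M)"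
  define B where "B = (\<integral>x. (b x)\<^sup>2 \<partial>?M)"
  define C where "C = (\<integral>x. \<bar>a x * b x\<bar> \<partial>?M)"
  have ia: "integrable ?M (\<lambda>x. (a x)\<^sup>2)" and ib: "integrable ?M (\<lambda>x. (b x)\<^sup>2)"
    and iab: "integrable ?M (\<lambda>x. \<bar>a x * b x\<bar>)"
    using a b integrable_mult_L2[OF a b] by (simp_all add: L2_space_def)
  have "A \<ge> 0" "B \<ge> 0" "C \<ge> 0" by (simp_all add: A_def B_def C_def)
  have quad: "0 \<le> A * s\<^sup>2 - 2 * C * s * r + B * r\<^sup>2" for s r
  proof -
    have "0 \<le> (\<integral>x. (s * \<bar>a x\<bar> - r * \<bar>b x\<bar>)\<^sup>2 \<partial>?M)"
      by simp
    also have "(\<lambda>x. (s * \<bar>a x\<bar> - r * \<bar>b x\<bar>)\<^sup>2) =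
        (\<lambda>x. s\<^sup>2 * (a x)\<^sup>2 - (2 * s * r) * \<bar>a x * b x\<bar> + r\<^sup>2 * (b x)\<^sup>2)"
      by (simp add: fun_eq_iff power2_diff power_mult_distrib abs_mult)
    also have "(\<integral>x. s\<^sup>2 * (a x)\<^sup>2 - (2 * s * r) * \<bar>a x * b x\<bar> + r\<^sup>2 * (b x)\<^sup>2 \<partial>?M) =
        s\<^sup>2 * A - (2 * s * r) * C + r\<^sup>2 * B"
      using ia ib iab by (simp add: A_def B_def C_def)
    finally show ?thesis by (simp add: algebra_simps)
  qed
  have "C\<^sup>2 \<le> A * B"
  proof (cases "A = 0")
    case True
    have "C = 0"
    proof (rule ccontr)
      assume "C \<noteq> 0"
      \<comment> \<open>For A = 0 the form is linear in s; this s gives it the value -2 (B + 1) + B,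
        which is negative.\<close>
      then have "2 * C * ((B + 1) / C) * 1 = 2 * (B + 1)" by simp
      then show False
        using quad[of "(B + 1) / C" 1] True \<open>B \<ge> 0\<close> by simp
    qed
    then show ?thesis by (simp add: True)
  next
    case False
    \<comment> \<open>The choice s = C, r = A turns the form into A (A B - C^2).\<close>
    have "0 \<le> A * C\<^sup>2 - 2 * C * C * A + B * A\<^sup>2" using quad[of C A] .
    then have "0 \<le> A * (A * B - C\<^sup>2)" by (simp add: power2_eq_square algebra_simps)
    then show ?thesis using False \<open>A \<ge> 0\<close> by (simp add: zero_le_mult_iff)
  qed
  then have "C \<le> sqrt (A * B)" by (rule real_le_rsqrt)
  then show ?thesis by (simp add: A_def B_def C_def norm_L2_def real_sqrt_mult)
qed

lemma ip_bound:
  assumes w: "continuous_on {0..L} w" and a: "a \<in> L2_space L" and b: "b \<in> L2_space L"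
    and K: "\<And>x. x \<in> {0..L} \<Longrightarrow> \<bar>w x\<bar> \<le> K" "K > 0"
  shows "\<bar>ip L w a b\<bar> \<le> K * (norm_L2 L a * norm_L2 L b)"
proof -
  let ?M = "interval_measure L"
  have "\<bar>ip L w a b\<bar> \<le> (\<integral>x. \<bar>w x * (a x * b x)\<bar> \<partial>?M)"
    unfolding ip_def by (rule integral_abs_bound)
  also have "\<dots> \<le> (\<integral>x. K * \<bar>a x * b x\<bar> \<partial>?M)"
  proof (rule integral_mono)
    show "\<bar>w x * (a x * b x)\<bar> \<le> K * \<bar>a x * b x\<bar>" if "x \<in> space ?M" for x
      using K(1)[of x] that by (auto simp: abs_mult intro!: mult_right_mono)
  qed (use integrable_ip[OF w a b] integrable_mult_L2[OF a b] in auto)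
  also have "\<dots> \<le> K * (norm_L2 L a * norm_L2 L b)"
    using Cauchy_Schwarz_L2[OF a b] K(2) by simp
  finally show ?thesis .
qed

section \<open>Limits and time derivatives of weighted pairings\<close>

text \<open>The integral of a non-integrable function is 0, so a small \<open>norm_L2\<close> says
  nothing without membership in the space. Membership is asked eventually because paths are
  controlled at times s \<ge> 0, which the filter \<open>at t within {0..}\<close> sees.\<close>

definition L2_tendsto :: "real \<Rightarrow> ('a \<Rightarrow> real \<Rightarrow> real) \<Rightarrow> (real \<Rightarrow> real) \<Rightarrow> 'a filter \<Rightarrow> bool" where
  "L2_tendsto L a l F \<longleftrightarrow> (\<forall>\<^sub>F s in F. a s \<in> L2_space L) \<and> l \<in> L2_space L \<and>
     ((\<lambda>s. norm_L2 L (\<lambda>x. a s x - l x)) \<longlongrightarrow> 0) F"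

lemma L2_tendsto_const: "l \<in> L2_space L \<Longrightarrow> L2_tendsto L (\<lambda>s. l) l F"
  by (simp add: L2_tendsto_def norm_L2_def)

text \<open>Bilinearity splits the difference into one small-small and two small-fixed pairings;
  Cauchy-Schwarz and a bound \<open>K\<close> of the weight on [0,L] handle each.\<close>

lemma tendsto_ip:
  assumes w: "continuous_on {0..L} w" and a: "L2_tendsto L a l F" and b: "L2_tendsto L b m F"
  shows "((\<lambda>s. ip L w (a s) (b s)) \<longlongrightarrow> ip L w l m) F"
proof -
  obtain K where K: "K > 0" "\<And>x. x \<in> {0..L} \<Longrightarrow> \<bar>w x\<bar> \<le> K"
    using continuous_imp_bounded_Icc[OF w] by blast
  have l: "l \<in> L2_space L" and m: "m \<in> L2_space L"
    using a b by (simp_all add: L2_tendsto_def)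
  let ?na = "\<lambda>s. norm_L2 L (\<lambda>x. a s x - l x)" and ?nb = "\<lambda>s. norm_L2 L (\<lambda>x. b s x - m x)"
  have na: "(?na \<longlongrightarrow> 0) F" and nb: "(?nb \<longlongrightarrow> 0) F"
    using a b by (simp_all add: L2_tendsto_def)
  have "\<forall>\<^sub>F s in F. a s \<in> L2_space L \<and> b s \<in> L2_space L"
    using a b by (simp add: L2_tendsto_def eventually_conj)
  then have bd: "\<forall>\<^sub>F s in F. norm (ip L w (a s) (b s) - ip L w l m)
      \<le> K * (?na s * ?nb s) + K * (?na s * norm_L2 L m) + K * (norm_L2 L l * ?nb s)"
  proof (rule eventually_mono)
    fix s assume s: "a s \<in> L2_space L \<and> b s \<in> L2_space L"
    have da: "(\<lambda>x. a s x - l x) \<in> L2_space L" and db: "(\<lambda>x. b s x - m x) \<in> L2_space L"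
      using s l m by (auto intro: L2_space_diff)
    have "ip L w (a s) (b s) - ip L w l m =
        ip L w (\<lambda>x. a s x - l x) (\<lambda>x. b s x - m x) + ip L w (\<lambda>x. a s x - l x) m
        + ip L w l (\<lambda>x. b s x - m x)"
      using s l m db by (simp add: ip_diff_left[OF w] ip_diff_right[OF w])
    then show "norm (ip L w (a s) (b s) - ip L w l m)
      \<le> K * (?na s * ?nb s) + K * (?na s * norm_L2 L m) + K * (norm_L2 L l * ?nb s)"
      using ip_bound[OF w da db K(2) K(1)] ip_bound[OF w da m K(2) K(1)] ip_bound[OF w l db K(2) K(1)]
      by simp
  qed
  have "((\<lambda>s. K * (?na s * ?nb s) + K * (?na s * norm_L2 L m) + K * (norm_L2 L l * ?nb s))
      \<longlongrightarrow> K * (0 * 0) + K * (0 * norm_L2 L m) + K * (norm_L2 L l * 0)) F"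
    by (intro tendsto_intros na nb)
  then have "((\<lambda>s. ip L w (a s) (b s) - ip L w l m) \<longlongrightarrow> 0) F"
    by (intro Lim_null_comparison[OF bd]) simp
  then show ?thesis by (simp add: LIM_zero_iff)
qed

text \<open>The increment is split as (a s - a t) b s + a t (b s - b t). The first difference
  quotient meets \<open>b s\<close> and not \<open>b t\<close>, hence the convergence assumption on
  \<open>b\<close>. At t > 0 the filter within {0..} is the full neighbourhood filter.\<close>

lemma has_field_derivative_ip:
  assumes w: "continuous_on {0..L} w"
    and a: "\<And>s. s \<ge> 0 \<Longrightarrow> a s \<in> L2_space L" and b: "\<And>s. s \<ge> 0 \<Longrightarrow> b s \<in> L2_space L"
    and bt: "L2_tendsto L b (b t) (at t within {0..})"
    and a': "L2_tendsto L (\<lambda>s x. (a s x - a t x) / (s - t)) a' (at t within {0..})"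
    and b': "L2_tendsto L (\<lambda>s x. (b s x - b t x) / (s - t)) b' (at t within {0..})"
    and t: "t > 0"
  shows "((\<lambda>s. ip L w (a s) (b s)) has_field_derivative ip L w a' (b t) + ip L w (a t) b') (at t)"
proof -
  let ?F = "at t within {0..}"
  have at: "a t \<in> L2_space L" and btm: "b t \<in> L2_space L" using a b t by auto
  have "((\<lambda>s. ip L w (\<lambda>x. (a s x - a t x) / (s - t)) (b s) +
              ip L w (a t) (\<lambda>x. (b s x - b t x) / (s - t)))
         \<longlongrightarrow> ip L w a' (b t) + ip L w (a t) b') ?F"
    by (intro tendsto_add tendsto_ip w a' b' bt L2_tendsto_const at)
  moreover have "\<forall>\<^sub>F s in ?F. ip L w (\<lambda>x. (a s x - a t x) / (s - t)) (b s) +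
              ip L w (a t) (\<lambda>x. (b s x - b t x) / (s - t)) =
        (ip L w (a s) (b s) - ip L w (a t) (b t)) / (s - t)"
  proof -
    have "ip L w (\<lambda>x. (a s x - a t x) / (s - t)) (b s) +
              ip L w (a t) (\<lambda>x. (b s x - b t x) / (s - t)) =
        (ip L w (a s) (b s) - ip L w (a t) (b t)) / (s - t)" if "s \<ge> 0" for s
    proof -
      have "ip L w (\<lambda>x. (a s x - a t x) / (s - t)) (b s) = (ip L w (a s) (b s) - ip L w (a t) (b s)) / (s - t)"
        using ip_lincomb_left[OF w a[OF that] at b[OF that], of "1 / (s - t)" "-1 / (s - t)"]
        by (simp add: diff_divide_distrib)
      moreover have "ip L w (a t) (\<lambda>x. (b s x - b t x) / (s - t)) = (ip L w (a t) (b s) - ip L w (a t) (b t)) / (s - t)"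
        using ip_lincomb_left[OF w b[OF that] btm at, of "1 / (s - t)" "-1 / (s - t)"]
        by (simp add: diff_divide_distrib ip_commute)
      ultimately show ?thesis by (simp add: diff_divide_distrib)
    qed
    then show ?thesis by (auto simp: eventually_at_filter)
  qed
  ultimately have "((\<lambda>s. ip L w (a s) (b s)) has_field_derivative ip L w a' (b t) + ip L w (a t) b') ?F"
    unfolding has_field_derivative_iff by (rule Lim_transform_eventually)
  moreover have "?F = at t" using t by (intro at_within_interior) simp
  ultimately show ?thesis by simp
qed

subsection \<open>Weak derivatives and the fundamental theorem of calculus\<close>

text \<open>A \<open>C\<^sup>1\<close> step: the difference of two scaled steps is a trapezoidal test function, whose derivative is a
  difference of two approximate identities. Testing a weak derivative against it yields the
  fundamental theorem of calculus without mollification.\<close>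

definition spline_step :: "real \<Rightarrow> real" where
  "spline_step s = 2 * (max 0 s)\<^sup>2 - 4 * (max 0 (s - 1/2))\<^sup>2 + 2 * (max 0 (s - 1))\<^sup>2"

text \<open>The hat function on [0,1] with peak 2 at 1/2, of mass one; it is the derivative of
  \<open>spline_step\<close>.\<close>

definition tent :: "real \<Rightarrow> real" where
  "tent s = 4 * max 0 s - 8 * max 0 (s - 1/2) + 4 * max 0 (s - 1)"

lemma DERIV_max_0_square: "((\<lambda>s. (max 0 s)\<^sup>2) has_real_derivative 2 * max 0 s) (at (s :: real))"
proof -
  consider "s > 0" | "s < 0" | "s = 0" by linarith
  then show ?thesis
  proof cases
    case 1
    have "((\<lambda>s. s\<^sup>2) has_real_derivative 2 * s) (at s)" by (auto intro!: derivative_eq_intros)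
    then have "((\<lambda>s. (max 0 s)\<^sup>2) has_real_derivative 2 * s) (at s)"
      by (rule has_field_derivative_transform_within_open[where S = "{0<..}"]) (use 1 in auto)
    then show ?thesis using 1 by simp
  next
    case 2
    have "((\<lambda>s. 0) has_real_derivative 0) (at s)" by simp
    then have "((\<lambda>s. (max 0 s)\<^sup>2) has_real_derivative 0) (at s)"
      by (rule has_field_derivative_transform_within_open[where S = "{..<0}"]) (use 2 in auto)
    then show ?thesis using 2 by simp
  next
    case 3
    have "((\<lambda>h. (max 0 h)\<^sup>2 / h) \<longlongrightarrow> 0) (at (0 :: real))"
    proof (rule Lim_null_comparison[where g = "\<lambda>h. \<bar>h\<bar>"])
      show "\<forall>\<^sub>F h in at (0 :: real). norm ((max 0 h)\<^sup>2 / h) \<le> \<bar>h\<bar>"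
        by (rule always_eventually) (auto simp: max_def power2_eq_square)
      show "((\<lambda>h :: real. \<bar>h\<bar>) \<longlongrightarrow> 0) (at 0)"
        by (auto intro!: tendsto_eq_intros)
    qed
    then show ?thesis using 3 by (simp add: has_field_derivative_iff)
  qed
qed

lemma DERIV_spline_step: "(spline_step has_real_derivative tent s) (at s)"
proof -
  have sh: "((\<lambda>s. (max 0 (s - c))\<^sup>2) has_real_derivative 2 * max 0 (s - c)) (at s)" for c :: real
    using DERIV_shift[of "\<lambda>s. (max 0 s)\<^sup>2" "2 * max 0 (s - c)" s "- c"] DERIV_max_0_square[of "s - c"]
    by simp
  show ?thesis unfolding spline_step_def[abs_def] tent_def
    using DERIV_add[OF DERIV_diff[OF DERIV_cmult[OF DERIV_max_0_square, of 2] DERIV_cmult[OF sh[of "1/2"], of 4]]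
      DERIV_cmult[OF sh[of 1], of 2]] by (simp add: mult.assoc)
qed

lemma tent_nonneg: "tent s \<ge> 0"
  by (auto simp: tent_def max_def)

lemma tent_eq_0: "s \<le> 0 \<or> s \<ge> 1 \<Longrightarrow> tent s = 0"
  by (auto simp: tent_def max_def)

lemma continuous_on_tent: "continuous_on S tent"
  unfolding tent_def[abs_def] by (intro continuous_intros)

lemma spline_step_eq_0: "s \<le> 0 \<Longrightarrow> spline_step s = 0"
  by (simp add: spline_step_def)

lemma spline_step_eq_1: "s \<ge> 1 \<Longrightarrow> spline_step s = 1"
  by (simp add: spline_step_def power2_eq_square algebra_simps)

lemma spline_step_mono: "s \<le> r \<Longrightarrow> spline_step s \<le> spline_step r"
  by (rule DERIV_nonneg_imp_nondecreasing) (use DERIV_spline_step tent_nonneg in blast)+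

lemma spline_step_bounds: "0 \<le> spline_step s" "spline_step s \<le> 1"
  using spline_step_mono[of "min s 0" s] spline_step_mono[of s "max s 1"]
  by (auto simp: spline_step_eq_0 spline_step_eq_1)

text \<open>The hat rescaled to [a, a + h] with mass one. It lies to the right of a, so a + h \<le>
  L is all that keeps its mass inside the interval.\<close>

definition bump :: "real \<Rightarrow> real \<Rightarrow> real \<Rightarrow> real" where
  "bump a h t = tent ((t - a) / h) / h"

lemma continuous_on_bump: "h > 0 \<Longrightarrow> continuous_on S (bump a h)"
  unfolding bump_def
  by (intro continuous_intros continuous_on_compose2[OF continuous_on_tent[of UNIV]]) auto

lemma DERIV_spline_step_scaled:
  "((\<lambda>t. spline_step ((t - a) / h)) has_real_derivative bump a h t) (at t)"
proof -
  have "((\<lambda>t. (t - a) / h) has_real_derivative 1 / h) (at t)"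
    by (cases "h = 0") (auto intro!: derivative_eq_intros)
  from DERIV_chain2[OF DERIV_spline_step this] show ?thesis by (simp add: bump_def)
qed

lemma integral_tent_scaled:
  assumes "0 \<le> a" "0 < h" "a + h \<le> L"
  shows "(\<integral>t. bump a h t \<partial>interval_measure L) = 1"
proof -
  have "((\<lambda>t. bump a h t) has_integral
      spline_step ((L - a) / h) - spline_step ((0 - a) / h)) {0..L}"
    using assms DERIV_spline_step_scaled
    by (intro fundamental_theorem_of_calculus)
       (auto simp flip: has_real_derivative_iff_has_vector_derivative intro: has_field_derivative_at_within)
  moreover have "spline_step ((L - a) / h) = 1" "spline_step ((0 - a) / h) = 0"
    using assms by (auto intro!: spline_step_eq_0 spline_step_eq_1 simp: field_simps)
  ultimately have "((\<lambda>t. bump a h t) has_integral 1) {0<..<L}"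
    by (simp add: has_integral_Icc_iff_Ioo)
  moreover have "continuous_on {0..L} (\<lambda>t. bump a h t)"
    using assms by (intro continuous_on_bump) simp
  ultimately show ?thesis
    by (simp add: lebesgue_integral_eq_integral L2_space_imp_integrable continuous_imp_L2_space integral_unique)
qed

text \<open>An approximate identity at work: the kernel is non-negative, has mass one, and lives so
  close to a that z differs from z a by at most e/2 there. The bound h < L - a secures the full
  mass.\<close>

lemma tendsto_integral_tent:
  assumes z: "continuous_on {0..L} z" and a: "0 < a" "a < L"
  shows "((\<lambda>h. \<integral>t. z t * (bump a h t) \<partial>interval_measure L) \<longlongrightarrow> z a) (at_right 0)"
proof (rule tendstoI)
  fix e :: real assume "e > 0"
  then have "e / 2 > 0" by simp
  moreover have "a \<in> {0..L}" using a by simp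
  ultimately obtain d where d: "d > 0" "\<And>t. t \<in> {0..L} \<Longrightarrow> dist t a < d \<Longrightarrow> dist (z t) (z a) < e / 2"
    using z unfolding continuous_on_iff by blast
  have "dist (\<integral>t. z t * (bump a h t) \<partial>interval_measure L) (z a) < e"
    if h: "0 < h" "h < min d (L - a)" for h
  proof -
    let ?k = "\<lambda>t. bump a h t"
    have k0: "?k t \<ge> 0" for t using tent_nonneg h by (simp add: bump_def)
    have ck: "continuous_on {0..L} ?k"
      using h by (intro continuous_on_bump) simp
    have ik: "integrable (interval_measure L) ?k"
      using ck by (intro L2_space_imp_integrable continuous_imp_L2_space)
    have izk: "integrable (interval_measure L) (\<lambda>t. z t * ?k t)"
      using ck z by (intro L2_space_imp_integrable continuous_imp_L2_space continuous_intros)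
    have k1: "(\<integral>t. ?k t \<partial>interval_measure L) = 1"
      using integral_tent_scaled[of a h L] a h by simp
    have "(\<integral>t. z t * ?k t \<partial>interval_measure L) - z a
        = (\<integral>t. z t * ?k t - z a * ?k t \<partial>interval_measure L)"
      using ik izk k1 by simp
    then have "\<bar>(\<integral>t. z t * ?k t \<partial>interval_measure L) - z a\<bar> \<le> (\<integral>t. \<bar>z t * ?k t - z a * ?k t\<bar> \<partial>interval_measure L)"
      by (simp only: integral_abs_bound)
    also have "\<dots> \<le> (\<integral>t. e / 2 * ?k t \<partial>interval_measure L)"
    proof (rule integral_mono)
      show "\<bar>z t * ?k t - z a * ?k t\<bar> \<le> e / 2 * ?k t" if t: "t \<in> space (interval_measure L)" for t
      proof (cases "dist t a < d")
        case True
        then have "\<bar>z t - z a\<bar> \<le> e / 2" using d(2)[of t] t by (auto simp: dist_real_def)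
        then have "\<bar>z t - z a\<bar> * ?k t \<le> e / 2 * ?k t" using k0 by (rule mult_right_mono)
        then show ?thesis using k0[of t] by (simp add: abs_mult flip: left_diff_distrib)
      next
        case False
        \<comment> \<open>A point at distance at least d > h from a lies outside the support
          [a, a + h].\<close>
        then have "(t - a) / h \<le> 0 \<or> (t - a) / h \<ge> 1"
          using h by (auto simp: dist_real_def field_simps abs_if split: if_splits)
        then have "?k t = 0" using tent_eq_0 by (simp add: bump_def)
        then show ?thesis by simp
      qed
    qed (use ik izk in auto)
    also have "\<dots> = e / 2" using ik k1 by simp
    finally show ?thesis using \<open>e > 0\<close> by (simp add: dist_real_def)
  qed
  then show "\<forall>\<^sub>F h in at_right 0. dist (\<integral>t. z t * (bump a h t) \<partial>interval_measure L) (z a) < e"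
    unfolding eventually_at_right_field using d a by (intro exI[of _ "min d (L - a)"]) auto
qed

text \<open>Steps have values in [0,1], so |g| dominates, and at each t the sequence is eventually
  constant. At t = a the step is 0, in agreement with the indicator of the open half-line.\<close>

lemma LIMSEQ_integral_spline_step:
  assumes g: "integrable (interval_measure L) g" and h: "filterlim h (at_right 0) sequentially"
  shows "(\<lambda>n. \<integral>t. g t * spline_step ((t - a) / h n) \<partial>interval_measure L)
     \<longlonglongrightarrow> (\<integral>t. g t * indicator {a<..} t \<partial>interval_measure L)"
proof (rule integral_dominated_convergence[where w = "\<lambda>t. \<bar>g t\<bar>"])
  have c: "spline_step \<in> borel_measurable borel"
    using DERIV_spline_step by (intro borel_measurable_continuous_onI DERIV_continuous_on) auto
  have id: "(\<lambda>t. t) \<in> borel_measurable (interval_measure L)"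
    by (rule continuous_borel_measurable_interval) simp
  have gm: "g \<in> borel_measurable (interval_measure L)" using g by simp
  show "(\<lambda>t. g t * spline_step ((t - a) / h n)) \<in> borel_measurable (interval_measure L)" for n
    using id by (intro borel_measurable_times gm measurable_compose[OF _ c]) simp
  show "(\<lambda>t. g t * indicator {a<..} t) \<in> borel_measurable (interval_measure L)"
    using id by (intro borel_measurable_times gm measurable_compose[OF id]) simp
  show "integrable (interval_measure L) (\<lambda>t. \<bar>g t\<bar>)" using g by simp
  show "AE t in interval_measure L. norm (g t * spline_step ((t - a) / h n)) \<le> \<bar>g t\<bar>" for n
    using spline_step_bounds by (auto simp: abs_mult intro!: AE_I2 mult_left_le)
  have pos: "\<forall>\<^sub>F n in sequentially. h n > 0" and h0: "h \<longlonglongrightarrow> 0"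
    using h by (auto simp: filterlim_at eventually_mono)
  have "(\<lambda>n. spline_step ((t - a) / h n)) \<longlonglongrightarrow> indicator {a<..} t" for t
  proof (rule tendsto_eventually, cases "t > a")
    case True
    then have "\<forall>\<^sub>F n in sequentially. h n < t - a" using order_tendstoD(2)[OF h0, of "t - a"] by simp
    with pos show "\<forall>\<^sub>F n in sequentially. spline_step ((t - a) / h n) = indicator {a<..} t"
      by eventually_elim (use True in \<open>simp add: spline_step_eq_1 field_simps\<close>)
  next
    case False
    from pos show "\<forall>\<^sub>F n in sequentially. spline_step ((t - a) / h n) = indicator {a<..} t"
      by eventually_elim (use False in \<open>simp add: spline_step_eq_0 divide_nonpos_pos\<close>)
  qed
  then show "AE t in interval_measure L. (\<lambda>n. g t * spline_step ((t - a) / h n)) \<longlonglongrightarrow> g t * indicator {a<..} t"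
    by (intro AE_I2 tendsto_mult tendsto_const)
qed

text \<open>Both steps vanish left of y and equal 1 right of x + h, so their difference is supported
  in [y, x + h]. This is compact in (0,L) because 0 < y and x + h < L.\<close>

lemma test_function_spline:
  assumes "0 < y" "y \<le> x" "0 < h" "x + h < L"
  shows "(\<lambda>t. spline_step ((t - y) / h) - spline_step ((t - x) / h)) \<in> test_functions L"
    and "deriv (\<lambda>t. spline_step ((t - y) / h) - spline_step ((t - x) / h)) =
      (\<lambda>t. bump y h t - bump x h t)"
proof -
  let ?f = "\<lambda>t. spline_step ((t - y) / h) - spline_step ((t - x) / h)"
  let ?d = "\<lambda>t. bump y h t - bump x h t"
  have D: "(?f has_real_derivative ?d t) (at t)" for t
    by (intro derivative_intros DERIV_spline_step_scaled)
  then show "deriv ?f = ?d" by (auto intro: DERIV_imp_deriv)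
  have "continuous_on UNIV ?d"
    using assms by (intro continuous_intros continuous_on_bump) auto
  then have "?f C1_differentiable_on UNIV"
    unfolding C1_differentiable_on_def
    by (intro exI[of _ ?d] conjI ballI) (simp_all only: D flip: has_real_derivative_iff_has_vector_derivative)
  moreover have "{t. ?f t \<noteq> 0} \<subseteq> {y..x + h}"
  proof
    fix t assume t: "t \<in> {t. ?f t \<noteq> 0}"
    show "t \<in> {y..x + h}"
    proof (rule ccontr)
      assume "t \<notin> {y..x + h}"
      then consider "t \<le> y" | "t \<ge> x + h" by force
      then show False
      proof cases
        case 1
        then have "(t - y) / h \<le> 0" "(t - x) / h \<le> 0" using assms by (auto simp: field_simps)
        then show False using t by (simp add: spline_step_eq_0)
      next
        case 2
        then have "(t - y) / h \<ge> 1" "(t - x) / h \<ge> 1" using assms by (auto simp: field_simps)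
        then show False using t by (simp add: spline_step_eq_1)
      qed
    qed
  qed
  then have "closure {t. ?f t \<noteq> 0} \<subseteq> {y..x + h}" by (rule closure_minimal) simp
  then have "closure {t. ?f t \<noteq> 0} \<subseteq> {0<..<L}" using assms by force
  ultimately show "?f \<in> test_functions L" by (simp add: test_functions_def)
qed



section \<open>Integral representation and uniqueness of weak derivatives\<close>

lemma L2_space_integrable_on: "g \<in> L2_space L \<Longrightarrow> g integrable_on {0..L}"
  using integrable_on_lebesgue_on[OF L2_space_imp_integrable] by (simp add: integrable_on_Icc_iff_Ioo)

text \<open>Tested against the trapezoid that rises after y and falls after x, the left side of the
  weak equation tends to z y - z x and the right side to minus the integral of g over [y,x], as the
  slopes steepen.\<close>

lemma weak_deriv_integral_Ioo:
  assumes z: "continuous_on {0..L} z" and g: "g \<in> L2_space L" and wd: "is_weak_deriv L z g"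
    and yx: "0 < y" "y \<le> x" "x < L"
  shows "z x - z y = integral {y..x} g"
proof -
  let ?M = "interval_measure L"
  \<comment> \<open>The 2 in the denominator gives h n < L - x strictly, already for n = 0.\<close>
  define h where "h n = (L - x) / real (n + 2)" for n
  have hpos: "h n > 0" and hL: "x + h n < L" for n
  proof -
    show "h n > 0" using yx by (simp add: h_def)
    have "(L - x) / real (n + 2) < (L - x) / 1"
      using yx by (intro divide_strict_left_mono) auto
    then have "h n < L - x" by (simp add: h_def)
    then show "x + h n < L" by simp
  qed
  have "h \<longlonglongrightarrow> 0"
    unfolding h_def by real_asymp
  then have hr: "filterlim h (at_right 0) sequentially"
    using hpos less_imp_neq[OF hpos, THEN not_sym] by (simp add: filterlim_at)
  have gi: "integrable ?M g" using g by (rule L2_space_imp_integrable)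
  have eq: "(\<integral>t. z t * bump y (h n) t \<partial>?M) - (\<integral>t. z t * bump x (h n) t \<partial>?M)
      = (\<integral>t. g t * spline_step ((t - x) / h n) \<partial>?M) - (\<integral>t. g t * spline_step ((t - y) / h n) \<partial>?M)" for n
  proof -
    have cs: "continuous_on {0..L} (\<lambda>t. spline_step ((t - a) / h n))" for a
      using DERIV_spline_step_scaled by (intro DERIV_continuous_on) (auto intro: has_field_derivative_at_within)
    have zb: "integrable ?M (\<lambda>t. z t * bump a (h n) t)" for a
      using z hpos by (intro L2_space_imp_integrable continuous_imp_L2_space continuous_intros continuous_on_bump)
    have gs: "integrable ?M (\<lambda>t. g t * spline_step ((t - a) / h n))" for a
      by (rule integrable_mult_L2[OF g continuous_imp_L2_space[OF cs]])
    have "(\<integral>t. z t * (bump y (h n) t - bump x (h n) t) \<partial>?M)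
        = - (\<integral>t. g t * (spline_step ((t - y) / h n) - spline_step ((t - x) / h n)) \<partial>?M)"
      using wd test_function_spline[OF yx(1,2) hpos hL, of n] by (auto simp: is_weak_deriv_def)
    then show ?thesis
      using zb gs by (simp add: right_diff_distrib)
  qed
  have "(\<lambda>n. (\<integral>t. z t * bump y (h n) t \<partial>?M) - (\<integral>t. z t * bump x (h n) t \<partial>?M)) \<longlonglongrightarrow> z y - z x"
    using yx by (intro tendsto_diff filterlim_compose[OF tendsto_integral_tent[OF z] hr]) auto
  moreover have "(\<lambda>n. (\<integral>t. g t * spline_step ((t - x) / h n) \<partial>?M) - (\<integral>t. g t * spline_step ((t - y) / h n) \<partial>?M))
     \<longlonglongrightarrow> (\<integral>t. g t * indicator {x<..} t \<partial>?M) - (\<integral>t. g t * indicator {y<..} t \<partial>?M)"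
    by (intro tendsto_diff LIMSEQ_integral_spline_step gi hr)
  ultimately have "z y - z x = (\<integral>t. g t * indicator {x<..} t \<partial>?M) - (\<integral>t. g t * indicator {y<..} t \<partial>?M)"
    unfolding eq by (rule LIMSEQ_unique)
  moreover have "(\<integral>t. g t * indicator {a<..} t \<partial>?M) = integral {a..L} g" if "0 < a" for a
  proof -
    have id: "(\<lambda>t. t) \<in> borel_measurable ?M"
      by (rule continuous_borel_measurable_interval) simp
    have "(\<lambda>t. g t * indicator {a<..} t) \<in> borel_measurable ?M"
      by (intro borel_measurable_times borel_measurable_integrable[OF gi] measurable_compose[OF id]) simp
    then have "integrable ?M (\<lambda>t. g t * indicator {a<..} t)"
      by (intro Bochner_Integration.integrable_bound[OF gi]) (auto simp: indicator_def)
    then have "(\<integral>t. g t * indicator {a<..} t \<partial>?M) = integral {0<..<L} (\<lambda>t. g t * indicator {a<..} t)"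
      by (intro lebesgue_integral_eq_integral) auto
    also have "\<dots> = integral {0<..<L} (\<lambda>t. if t \<in> {a<..} then g t else 0)"
      by (rule integral_cong) auto
    also have "\<dots> = integral {a<..<L} g"
      using that by (subst integral_restrict_Int) (auto intro!: arg_cong[where f = "\<lambda>S. integral S g"])
    also have "\<dots> = integral {a..L} g"
      by (simp add: integral_open_interval_real)
    finally show ?thesis .
  qed
  moreover have "g integrable_on {0..L}" using g by (rule L2_space_integrable_on)
  then have "integral {y..x} g + integral {x..L} g = integral {y..L} g"
    using yx by (intro Henstock_Kurzweil_Integration.integral_combine) (auto intro: integrable_subinterval_real)
  ultimately show ?thesis using yx by simp
qed

text \<open>The function z minus the indefinite integral of g is constant on the open interval. It
  is continuous on the closed one, so the constant reaches the endpoints, which no test function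
  sees.\<close>

lemma weak_deriv_integral:
  assumes "0 < L" and z: "continuous_on {0..L} z" and g: "g \<in> L2_space L" and wd: "is_weak_deriv L z g"
    and x: "x \<in> {0..L}"
  shows "z x = z 0 + integral {0..x} g"
proof -
  let ?G = "\<lambda>x. z x - integral {0..x} g"
  have gi: "g integrable_on {0..L}" using g by (rule L2_space_integrable_on)
  have c: "continuous_on (closure {0<..<L}) ?G"
    using \<open>0 < L\<close> by (auto intro!: continuous_intros z indefinite_integral_continuous_1 gi)
  have "?G y = ?G (L/2)" if y: "y \<in> {0<..<L}" for y
  proof -
    have *: "?G a = ?G b" if "0 < a" "a \<le> b" "b < L" for a b
    proof -
      have "integral {0..a} g + integral {a..b} g = integral {0..b} g"
        using that by (intro Henstock_Kurzweil_Integration.integral_combine)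
          (auto intro: integrable_subinterval_real[OF gi])
      then show ?thesis
        using weak_deriv_integral_Ioo[OF z g wd that] by simp
    qed
    show ?thesis
      using *[of y "L/2"] *[of "L/2" y] y \<open>0 < L\<close> by (cases "y \<le> L/2") auto
  qed
  then have mid: "\<And>y. y \<in> {0<..<L} \<Longrightarrow> ?G y = ?G (L/2)" .
  have G: "?G y = ?G (L/2)" if "y \<in> {0..L}" for y
  proof (rule continuous_constant_on_closure[OF c])
    show "y \<in> closure {0<..<L}" using that \<open>0 < L\<close> by simp
  qed (rule mid)
  have "?G x = ?G 0"
    using G[of x] G[of 0] x \<open>0 < L\<close> by auto
  then show ?thesis by simp
qed

text \<open>By the integral representation, g has integral 0 over every subinterval of [0,L].
  Extended by zero, its averages over all intervals vanish, and outside a null set these averages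
  converge to its values.\<close>

lemma weak_deriv_0_AE:
  assumes "0 < L" and g: "g \<in> L2_space L" and wd: "is_weak_deriv L (\<lambda>x. 0) g"
  shows "AE x in interval_measure L. g x = 0"
proof -
  let ?f = "\<lambda>x. if x \<in> {0..L} then g x else 0"
  have gi: "g integrable_on {0..L}" using g by (rule L2_space_integrable_on)
  have I0: "integral {0..x} g = 0" if "x \<in> {0..L}" for x
    using weak_deriv_integral[OF assms(1) _ g wd that] by simp
  have sub: "g integrable_on {max a 0..min b L}" "integral {max a 0..min b L} g = 0" for a b
  proof -
    show gs: "g integrable_on {max a 0..min b L}"
      by (rule integrable_subinterval_real[OF gi]) auto
    show "integral {max a 0..min b L} g = 0"
    proof (cases "max a 0 \<le> min b L")
      case True
      then have "integral {0..max a 0} g + integral {max a 0..min b L} g = integral {0..min b L} g"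
        by (intro Henstock_Kurzweil_Integration.integral_combine integrable_subinterval_real[OF gi]) auto
      then show ?thesis using True I0[of "max a 0"] I0[of "min b L"] by auto
    qed auto
  qed
  have Int: "{0..L} \<inter> cbox a b = {max a 0..min b L}" for a b :: real by auto
  have "?f integrable_on cbox a b" for a b
    unfolding integrable_restrict_Int Int by (rule sub)
  \<comment> \<open>Lebesgue's differentiation theorem\<close>
  then obtain N where N: "negligible N"
    "\<And>x e. \<lbrakk>x \<notin> N; 0 < e\<rbrakk> \<Longrightarrow> \<exists>d>0. \<forall>h. 0 < h \<and> h < d \<longrightarrow>
        norm (integral (cbox x (x + h *\<^sub>R One)) ?f /\<^sub>R h ^ DIM(real) - ?f x) < e"
    by (rule integrable_ccontinuous_explicit) (rule that)
  have "?f x = 0" if xN: "x \<notin> N" for x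
  proof (rule ccontr)
    assume "?f x \<noteq> 0"
    then obtain d where d: "d > 0" "\<And>h. 0 < h \<Longrightarrow> h < d \<Longrightarrow>
        norm (integral (cbox x (x + h *\<^sub>R One)) ?f /\<^sub>R h ^ DIM(real) - ?f x) < \<bar>?f x\<bar>"
      using N(2)[OF xN, of "\<bar>?f x\<bar>"] unfolding zero_less_abs_iff by blast
    have "integral (cbox a b) ?f = 0" for a b :: real
      unfolding integral_restrict_Int Int by (rule sub)
    then show False using d(2)[of "d/2"] \<open>d > 0\<close> by simp
  qed
  then have "g x = 0" if "x \<notin> N" "x \<in> {0<..<L}" for x
    using that by (metis atLeastAtMost_iff greaterThanLessThan_iff less_imp_le)
  then have "{x. \<not> (x \<in> {0<..<L} \<longrightarrow> g x = 0)} \<subseteq> N" by blast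
  then have "AE x in lebesgue. x \<in> {0<..<L} \<longrightarrow> g x = 0"
    using N(1) by (intro AE_I'[of N]) (auto simp: negligible_iff_null_sets)
  then show ?thesis by (simp add: AE_restrict_space_iff)
qed

subsection \<open>Integration by parts in the Sobolev space\<close>

lemma test_function_L2:
  assumes "\<phi> \<in> test_functions L"
  shows "\<phi> \<in> L2_space L" "deriv \<phi> \<in> L2_space L"
proof -
  obtain D where D: "\<And>x. (\<phi> has_real_derivative D x) (at x)" "continuous_on UNIV D"
    using assms unfolding test_functions_def C1_differentiable_on_def
    by (auto simp flip: has_real_derivative_iff_has_vector_derivative)
  then have "deriv \<phi> = D" by (auto intro: DERIV_imp_deriv)
  moreover have "continuous_on {0..L} \<phi>"
    using D(1) by (intro DERIV_continuous_on) (auto intro: has_field_derivative_at_within)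
  moreover have "continuous_on {0..L} D" using D(2) continuous_on_subset by blast
  ultimately show "\<phi> \<in> L2_space L" "deriv \<phi> \<in> L2_space L"
    by (simp_all add: continuous_imp_L2_space)
qed

lemma is_weak_deriv_lincomb:
  assumes "is_weak_deriv L z g" "is_weak_deriv L z' g'"
    and "z \<in> L2_space L" "z' \<in> L2_space L" "g \<in> L2_space L" "g' \<in> L2_space L"
  shows "is_weak_deriv L (\<lambda>x. c * z x + d * z' x) (\<lambda>x. c * g x + d * g' x)"
  unfolding is_weak_deriv_def
proof
  fix \<phi> assume \<phi>: "\<phi> \<in> test_functions L"
  let ?M = "interval_measure L"
  note L2 = test_function_L2[OF \<phi>]
  have lin: "(\<integral>x. (c * a x + d * b x) * \<psi> x \<partial>?M) = c * (\<integral>x. a x * \<psi> x \<partial>?M) + d * (\<integral>x. b x * \<psi> x \<partial>?M)"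
    if "a \<in> L2_space L" "b \<in> L2_space L" "\<psi> \<in> L2_space L" for a b \<psi>
    using integrable_mult_L2[OF that(1,3)] integrable_mult_L2[OF that(2,3)]
    by (simp add: distrib_right mult.assoc)
  show "(\<integral>x. (c * z x + d * z' x) * deriv \<phi> x \<partial>?M) = - (\<integral>x. (c * g x + d * g' x) * \<phi> x \<partial>?M)"
    using assms(1,2) \<phi> by (simp add: lin assms L2 is_weak_deriv_def)
qed

lemma is_weak_deriv_unique:
  assumes "0 < L" "is_weak_deriv L z g" "is_weak_deriv L z h"
    and "z \<in> L2_space L" "g \<in> L2_space L" "h \<in> L2_space L"
  shows "AE x in interval_measure L. g x = h x"
proof -
  have "is_weak_deriv L (\<lambda>x. 0) (\<lambda>x. g x - h x)"
    using is_weak_deriv_lincomb[OF assms(2,3,4,4,5,6), of 1 "-1"] by simp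
  from weak_deriv_0_AE[OF assms(1) L2_space_diff[OF assms(5,6)] this] show ?thesis by simp
qed

text \<open>The choice in \<open>wderiv\<close> is satisfiable: a weak derivative in H1 is taken if
  there is one, and any weak derivative in L2 otherwise.\<close>

lemma wderiv_H1:
  assumes "z \<in> H1_space L"
  shows "wderiv L z \<in> L2_space L" "is_weak_deriv L z (wderiv L z)"
proof -
  let ?P = "\<lambda>g. g \<in> L2_space L \<and> is_weak_deriv L z g \<and>
                   ((\<exists>h\<in>H1_space L. is_weak_deriv L z h) \<longrightarrow> g \<in> H1_space L)"
  have "\<exists>g. ?P g"
    using assms unfolding H1_space_def by blast
  then have "?P (wderiv L z)" unfolding wderiv_def by (rule someI_ex)
  then show "wderiv L z \<in> L2_space L" "is_weak_deriv L z (wderiv L z)" by auto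
qed

text \<open>The implication inside the choice now has a true premise, so the chosen derivative is
  the continuous representative. Its value at L is therefore a genuine trace.\<close>

lemma wderiv_H2:
  assumes "z \<in> H2_space L"
  shows "wderiv L z \<in> H1_space L"
proof -
  let ?P = "\<lambda>g. g \<in> L2_space L \<and> is_weak_deriv L z g \<and>
                   ((\<exists>h\<in>H1_space L. is_weak_deriv L z h) \<longrightarrow> g \<in> H1_space L)"
  have "\<exists>g. ?P g"
    using assms unfolding H2_space_def H1_space_def by blast
  then have "?P (wderiv L z)" unfolding wderiv_def by (rule someI_ex)
  then show ?thesis using assms by (auto simp: H2_space_def)
qed

lemma H1_space_imp_L2: "z \<in> H1_space L \<Longrightarrow> z \<in> L2_space L"
  and H1_space_imp_continuous: "z \<in> H1_space L \<Longrightarrow> continuous_on {0..L} z"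
  by (simp_all add: H1_space_def)

lemma H1_space_lincomb:
  assumes "z \<in> H1_space L" "z' \<in> H1_space L"
  shows "(\<lambda>x. c * z x + d * z' x) \<in> H1_space L"
proof -
  have "is_weak_deriv L (\<lambda>x. c * z x + d * z' x) (\<lambda>x. c * wderiv L z x + d * wderiv L z' x)"
    using assms by (intro is_weak_deriv_lincomb wderiv_H1 H1_space_imp_L2)
  moreover have "(\<lambda>x. c * wderiv L z x + d * wderiv L z' x) \<in> L2_space L"
    using assms by (intro L2_space_lincomb wderiv_H1)
  moreover have "continuous_on {0..L} (\<lambda>x. c * z x + d * z' x)"
    using assms by (intro continuous_intros H1_space_imp_continuous)
  ultimately show ?thesis
    using assms L2_space_lincomb[of z L z' c d] by (auto simp: H1_space_def)
qed

text \<open>Both sides are weak derivatives of the same function, chosen independently of each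
  other, hence equality almost everywhere. L2 norms and pairings do not notice the
  difference.\<close>

lemma wderiv_lincomb:
  assumes "0 < L" "z \<in> H1_space L" "z' \<in> H1_space L"
  shows "AE x in interval_measure L. wderiv L (\<lambda>x. c * z x + d * z' x) x = c * wderiv L z x + d * wderiv L z' x"
proof (rule is_weak_deriv_unique[OF assms(1)])
  show "is_weak_deriv L (\<lambda>x. c * z x + d * z' x) (\<lambda>x. c * wderiv L z x + d * wderiv L z' x)"
    using assms by (intro is_weak_deriv_lincomb wderiv_H1 H1_space_imp_L2)
  show "(\<lambda>x. c * wderiv L z x + d * wderiv L z' x) \<in> L2_space L"
    using assms by (intro L2_space_lincomb wderiv_H1)
qed (use H1_space_lincomb[OF assms(2,3), of c d] wderiv_H1 H1_space_imp_L2 in blast)+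

lemma norm_wderiv_diff:
  assumes "0 < L" "z \<in> H1_space L" "z' \<in> H1_space L"
  shows "norm_L2 L (\<lambda>x. wderiv L z x - wderiv L z' x) \<le> norm_H1 L (\<lambda>x. z x - z' x)"
proof -
  have "norm_L2 L (\<lambda>x. wderiv L z x - wderiv L z' x) = norm_L2 L (wderiv L (\<lambda>x. z x - z' x))"
    using wderiv_lincomb[OF assms, of 1 "-1"] wderiv_H1(1)[OF assms(2)] wderiv_H1(1)[OF assms(3)]
      wderiv_H1(1)[OF H1_space_lincomb[OF assms(2,3), of 1 "-1"]]
    by (intro norm_L2_cong_AE) (auto simp: L2_space_def)
  also have "\<dots> \<le> norm_H1 L (\<lambda>x. z x - z' x)"
    unfolding norm_H1_def by (rule real_le_rsqrt) simp
  finally show ?thesis .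
qed

text \<open>Linearity almost everywhere lets the difference quotient pass under
  \<open>wderiv\<close>; the H1 norm then dominates the L2 norm of the derivative.\<close>

lemma norm_wderiv_quotient:
  assumes "0 < L" "z \<in> H1_space L" "z' \<in> H1_space L" "z'' \<in> H1_space L"
  shows "norm_L2 L (\<lambda>x. (wderiv L z x - wderiv L z' x) / h - wderiv L z'' x)
    \<le> norm_H1 L (\<lambda>x. (z x - z' x) / h - z'' x)"
proof -
  have q: "(\<lambda>x. (z x - z' x) / h) \<in> H1_space L"
    using H1_space_lincomb[OF assms(2,3), of "1/h" "-1/h"] by (simp add: diff_divide_distrib)
  have "AE x in interval_measure L.
      wderiv L (\<lambda>x. (z x - z' x) / h) x = (wderiv L z x - wderiv L z' x) / h"
    using wderiv_lincomb[OF assms(1-3), of "1/h" "-1/h"] by (simp add: diff_divide_distrib)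
  then have "norm_L2 L (\<lambda>x. (wderiv L z x - wderiv L z' x) / h - wderiv L z'' x)
      = norm_L2 L (\<lambda>x. wderiv L (\<lambda>x. (z x - z' x) / h) x - wderiv L z'' x)"
    using assms wderiv_H1(1)[OF q]
      L2_space_diff[OF L2_space_quotient[OF wderiv_H1(1) wderiv_H1(1)] wderiv_H1(1)]
      L2_space_diff[OF wderiv_H1(1)[OF q] wderiv_H1(1)[OF assms(4)]]
    by (intro norm_L2_cong_AE) (auto simp: L2_space_def)
  also have "\<dots> \<le> norm_H1 L (\<lambda>x. (z x - z' x) / h - z'' x)"
    by (rule norm_wderiv_diff[OF assms(1) q assms(4)])
  finally show ?thesis .
qed

section \<open>Product rule for indefinite Lebesgue integrals\<close>

text \<open>Absolute continuity on [0,L] in integrated form. Since \<open>f'\<close> need only be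
  integrable, the class is closed under products, so the rule can be iterated to reach x f
  g.\<close>

definition has_integral_deriv :: "real \<Rightarrow> (real \<Rightarrow> real) \<Rightarrow> (real \<Rightarrow> real) \<Rightarrow> bool" where
  "has_integral_deriv L f f' \<longleftrightarrow> integrable (interval_measure L) f' \<and>
     (\<forall>x\<in>{0..L}. f x = f 0 + (\<integral>y. f' y \<partial>interval_measure x))"

lemma has_integral_derivD:
  "has_integral_deriv L f f' \<Longrightarrow> x \<in> {0..L} \<Longrightarrow> f x = f 0 + (\<integral>y. f' y \<partial>interval_measure x)"
  unfolding has_integral_deriv_def by blast

lemma integrable_interval_measure_mono:
  assumes "integrable (interval_measure L) (f :: real \<Rightarrow> real)" "x \<le> L"
  shows "integrable (interval_measure x) f"
proof -
  have "set_integrable lebesgue {0<..<L} f"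
    using assms(1) by (simp add: set_integrable_def integrable_restrict_space)
  then have "set_integrable lebesgue {0<..<x} f"
    by (rule set_integrable_subset) (use assms(2) in auto)
  then show ?thesis by (simp add: set_integrable_def integrable_restrict_space)
qed

lemma has_integral_deriv_H1:
  assumes "0 < L" "z \<in> H1_space L" "g \<in> L2_space L" "is_weak_deriv L z g"
  shows "has_integral_deriv L z g"
  unfolding has_integral_deriv_def
proof (intro conjI ballI)
  show gi: "integrable (interval_measure L) g" using assms(3) by (rule L2_space_imp_integrable)
  fix x assume x: "x \<in> {0..L}"
  have "(\<integral>y. g y \<partial>interval_measure x) = integral {0<..<x} g"
    using integrable_interval_measure_mono[OF gi] x by (intro lebesgue_integral_eq_integral) auto
  then have "(\<integral>y. g y \<partial>interval_measure x) = integral {0..x} g"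
    by (simp add: integral_open_interval_real)
  then show "z x = z 0 + (\<integral>y. g y \<partial>interval_measure x)"
    using weak_deriv_integral[OF assms(1) H1_space_imp_continuous[OF assms(2)] assms(3,4) x] by simp
qed

lemma integral_interval_measure_indicator:
  fixes f :: "real \<Rightarrow> real"
  assumes "x \<le> L"
  shows "(\<integral>y. indicator {..<x} y * f y \<partial>interval_measure L) = (\<integral>y. f y \<partial>interval_measure x)"
proof -
  have "(\<integral>y. indicator {..<x} y * f y \<partial>interval_measure L)
      = (\<integral>y. indicator {0<..<L} y *\<^sub>R (indicator {..<x} y * f y) \<partial>lebesgue)"
    by (rule integral_restrict_space) simp
  also have "\<dots> = (\<integral>y. indicator {0<..<x} y *\<^sub>R f y \<partial>lebesgue)"
    using assms by (intro Bochner_Integration.integral_cong) (auto simp: indicator_def)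
  also have "\<dots> = (\<integral>y. f y \<partial>interval_measure x)"
    by (rule integral_restrict_space[symmetric]) simp
  finally show ?thesis .
qed

text \<open>The point x is a null set. The closed half-line is needed because one of the two
  triangles of the square contains the diagonal.\<close>

lemma integral_interval_measure_indicator':
  fixes f :: "real \<Rightarrow> real"
  assumes "x \<le> L" "integrable (interval_measure L) f"
  shows "(\<integral>y. indicator {..x} y * f y \<partial>interval_measure L) = (\<integral>y. f y \<partial>interval_measure x)"
proof -
  have "(\<integral>y. indicator {..x} y * f y \<partial>interval_measure L)
      = (\<integral>y. indicator {0<..<L} y *\<^sub>R (indicator {..x} y * f y) \<partial>lebesgue)"
    by (rule integral_restrict_space) simp
  also have "\<dots> = (\<integral>y. indicator {0<..<L} y *\<^sub>R (indicator {..<x} y * f y) \<partial>lebesgue)"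
  proof (rule integral_cong_AE)
    have m: "(\<lambda>y. indicator {0<..<L} y *\<^sub>R f y) \<in> borel_measurable lebesgue"
      using assms(2) by (simp add: integrable_restrict_space borel_measurable_integrable)
    have "(\<lambda>y. indicator S y * (indicator {0<..<L} y *\<^sub>R f y)) \<in> borel_measurable lebesgue"
      if "S \<in> sets lebesgue" for S
      using that by (intro borel_measurable_times m borel_measurable_indicator)
    from this[of "{..x}"] this[of "{..<x}"]
    show "(\<lambda>y. indicator {0<..<L} y *\<^sub>R (indicator {..x} y * f y)) \<in> borel_measurable lebesgue"
      "(\<lambda>y. indicator {0<..<L} y *\<^sub>R (indicator {..<x} y * f y)) \<in> borel_measurable lebesgue"
      by (simp_all add: ac_simps)
    have "AE y in lebesgue. y \<noteq> x"
      by (rule AE_I'[of "{x}"]) auto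
    then show "AE y in lebesgue. indicator {0<..<L} y *\<^sub>R (indicator {..x} y * f y)
        = indicator {0<..<L} y *\<^sub>R (indicator {..<x} y * f y)"
      by eventually_elim (auto simp: indicator_def)
  qed
  also have "\<dots> = (\<integral>y. indicator {..<x} y * f y \<partial>interval_measure L)"
    by (rule integral_restrict_space[symmetric]) simp
  finally show ?thesis by (simp add: integral_interval_measure_indicator assms)
qed

text \<open>Fubini on the square, split along its diagonal.\<close>

lemma integral_product_rule:
  fixes f g :: "real \<Rightarrow> real"
  assumes f: "integrable (interval_measure b) f" and g: "integrable (interval_measure b) g"
  shows "(\<integral>x. f x * (\<integral>y. g y \<partial>interval_measure x) \<partial>interval_measure b)
       + (\<integral>y. (\<integral>x. f x \<partial>interval_measure y) * g y \<partial>interval_measure b)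
       = (\<integral>x. f x \<partial>interval_measure b) * (\<integral>y. g y \<partial>interval_measure b)"
proof -
  let ?M = "interval_measure b"
  interpret finite_measure ?M by (rule finite_interval_measure)
  interpret P: pair_sigma_finite ?M ?M ..
  have [measurable]: "f \<in> borel_measurable ?M" "g \<in> borel_measurable ?M"
    using f g by simp_all
  have [measurable]: "(\<lambda>t. t) \<in> borel_measurable ?M"
    by (rule continuous_borel_measurable_interval) simp
  have idf [measurable]: "fst \<in> borel_measurable (?M \<Otimes>\<^sub>M ?M)" "snd \<in> borel_measurable (?M \<Otimes>\<^sub>M ?M)"
    using measurable_compose[OF measurable_fst \<open>(\<lambda>t. t) \<in> borel_measurable ?M\<close>]
      measurable_compose[OF measurable_snd \<open>(\<lambda>t. t) \<in> borel_measurable ?M\<close>] by simp_all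
  have "integrable (?M \<Otimes>\<^sub>M ?M) (\<lambda>p. f (fst p) * g (snd p))"
  proof (rule P.Fubini_integrable)
    show "(\<lambda>p. f (fst p) * g (snd p)) \<in> borel_measurable (?M \<Otimes>\<^sub>M ?M)" by measurable
  qed (use f g in \<open>simp_all add: abs_mult\<close>)
  note fg = this
  have int: "integrable (?M \<Otimes>\<^sub>M ?M) (\<lambda>p. indicator S p * (f (fst p) * g (snd p)))"
    if "S \<in> sets (?M \<Otimes>\<^sub>M ?M)" for S
    using integrable_real_mult_indicator[OF that fg] by (simp only: mult.commute)
  have sp: "space (?M \<Otimes>\<^sub>M ?M) = {0<..<b} \<times> {0<..<b}" by (simp add: space_pair_measure)
  \<comment> \<open>The inequality is strict in \<open>S\<close> and weak in \<open>T\<close>, so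
    the two sets partition the square and their indicators add up to 1 there.\<close>
  define S where "S = {p \<in> space (?M \<Otimes>\<^sub>M ?M). snd p < fst p}"
  define T where "T = {p \<in> space (?M \<Otimes>\<^sub>M ?M). fst p \<le> snd p}"
  have S: "S \<in> sets (?M \<Otimes>\<^sub>M ?M)" and T: "T \<in> sets (?M \<Otimes>\<^sub>M ?M)"
    unfolding S_def T_def by measurable
  let ?k = "\<lambda>A x y. indicator A (x, y) * (f x * g y)"
  have intS: "integrable (?M \<Otimes>\<^sub>M ?M) (case_prod (?k S))" and intT: "integrable (?M \<Otimes>\<^sub>M ?M) (case_prod (?k T))"
    using int[OF S] int[OF T] by (simp_all add: case_prod_unfold)
  have "(\<integral>x. f x * (\<integral>y. g y \<partial>interval_measure x) \<partial>?M) = (\<integral>x. (\<integral>y. ?k S x y \<partial>?M) \<partial>?M)"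
  proof (rule Bochner_Integration.integral_cong[OF refl])
    fix x assume x: "x \<in> space ?M"
    have "(\<integral>y. ?k S x y \<partial>?M) = (\<integral>y. f x * (indicator {..<x} y * g y) \<partial>?M)"
      by (rule Bochner_Integration.integral_cong) (use x in \<open>auto simp: S_def sp indicator_def\<close>)
    then show "f x * (\<integral>y. g y \<partial>interval_measure x) = (\<integral>y. ?k S x y \<partial>?M)"
      using x by (simp add: integral_interval_measure_indicator)
  qed
  moreover have "(\<integral>y. (\<integral>x. f x \<partial>interval_measure y) * g y \<partial>?M) = (\<integral>x. (\<integral>y. ?k T x y \<partial>?M) \<partial>?M)"
  proof -
    have "(\<integral>y. (\<integral>x. f x \<partial>interval_measure y) * g y \<partial>?M) = (\<integral>y. (\<integral>x. ?k T x y \<partial>?M) \<partial>?M)"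
    proof (rule Bochner_Integration.integral_cong[OF refl])
      fix y assume y: "y \<in> space ?M"
      have "(\<integral>x. ?k T x y \<partial>?M) = (\<integral>x. (indicator {..y} x * f x) * g y \<partial>?M)"
        by (rule Bochner_Integration.integral_cong) (use y in \<open>auto simp: T_def sp indicator_def\<close>)
      then show "(\<integral>x. f x \<partial>interval_measure y) * g y = (\<integral>x. ?k T x y \<partial>?M)"
        using y f by (simp add: integral_interval_measure_indicator')
    qed
    also have "\<dots> = (\<integral>x. (\<integral>y. ?k T x y \<partial>?M) \<partial>?M)"
      by (rule P.Fubini_integral[OF intT])
    finally show ?thesis .
  qed
  moreover have "(\<integral>x. (\<integral>y. ?k S x y \<partial>?M) \<partial>?M) + (\<integral>x. (\<integral>y. ?k T x y \<partial>?M) \<partial>?M)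
      = (\<integral>x. (\<integral>y. f x * g y \<partial>?M) \<partial>?M)"
  proof -
    have "(\<integral>x. (\<integral>y. ?k S x y \<partial>?M) \<partial>?M) + (\<integral>x. (\<integral>y. ?k T x y \<partial>?M) \<partial>?M)
       = (\<integral>p. case_prod (?k S) p + case_prod (?k T) p \<partial>(?M \<Otimes>\<^sub>M ?M))"
      unfolding P.integral_fst[OF intS] P.integral_fst[OF intT]
      by (rule Bochner_Integration.integral_add[OF intS intT, symmetric])
    also have "\<dots> = (\<integral>p. f (fst p) * g (snd p) \<partial>(?M \<Otimes>\<^sub>M ?M))"
      by (rule Bochner_Integration.integral_cong) (auto simp: S_def T_def sp indicator_def)
    also have "\<dots> = (\<integral>x. (\<integral>y. f x * g y \<partial>?M) \<partial>?M)"
      using P.integral_fst'[OF fg] by simp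
    finally show ?thesis .
  qed
  ultimately show ?thesis by simp
qed

lemma has_integral_deriv_continuous:
  assumes "has_integral_deriv L f f'"
  shows "continuous_on {0..L} f"
proof -
  have fi: "integrable (interval_measure L) f'" using assms by (simp add: has_integral_deriv_def)
  then have "f' integrable_on {0..L}"
    using integrable_on_lebesgue_on[OF fi] by (simp add: integrable_on_Icc_iff_Ioo)
  then have c: "continuous_on {0..L} (\<lambda>x. f 0 + integral {0..x} f')"
    by (intro continuous_intros indefinite_integral_continuous_1)
  have eq: "f 0 + integral {0..x} f' = f x" if x: "x \<in> {0..L}" for x
  proof -
    have "(\<integral>y. f' y \<partial>interval_measure x) = integral {0<..<x} f'"
      using integrable_interval_measure_mono[OF fi] x by (intro lebesgue_integral_eq_integral) auto
    then show ?thesis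
      unfolding has_integral_derivD[OF assms x] by (simp add: integral_open_interval_real)
  qed
  show ?thesis by (rule continuous_on_eq[OF c eq])
qed

lemma integrable_mult_continuous:
  fixes f g :: "real \<Rightarrow> real"
  assumes f: "integrable (interval_measure L) f" and g: "continuous_on {0..L} g"
  shows "integrable (interval_measure L) (\<lambda>x. f x * g x)"
proof -
  obtain K where K: "K > 0" "\<And>x. x \<in> {0..L} \<Longrightarrow> \<bar>g x\<bar> \<le> K"
    using continuous_imp_bounded_Icc[OF g] by blast
  show ?thesis
  proof (rule Bochner_Integration.integrable_bound)
    show "integrable (interval_measure L) (\<lambda>x. K * f x)" using f by simp
    show "(\<lambda>x. f x * g x) \<in> borel_measurable (interval_measure L)"
      using f continuous_borel_measurable_interval[OF g] by (intro borel_measurable_times) auto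
    have "\<bar>f x * g x\<bar> \<le> \<bar>K * f x\<bar>" if "x \<in> {0<..<L}" for x
      using K(2)[of x] K(1) that mult_right_mono[of "\<bar>g x\<bar>" K "\<bar>f x\<bar>"]
      by (simp add: abs_mult mult.commute)
    then show "AE x in interval_measure L. norm (f x * g x) \<le> norm (K * f x)"
      by (auto intro!: AE_I2)
  qed
qed

text \<open>With f = f 0 + F and g = g 0 + G, where F and G are the indefinite integrals, the
  product rule for integrals gives F G. The terms with f 0 and g 0 complete it to f g - f 0 g
  0.\<close>

lemma has_integral_deriv_mult:
  assumes f: "has_integral_deriv L f f'" and g: "has_integral_deriv L g g'"
  shows "has_integral_deriv L (\<lambda>x. f x * g x) (\<lambda>x. f' x * g x + g' x * f x)"
  unfolding has_integral_deriv_def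
proof (intro conjI ballI)
  have fi: "integrable (interval_measure L) f'" and gi: "integrable (interval_measure L) g'"
    using f g by (simp_all add: has_integral_deriv_def)
  have fc: "continuous_on {0..L} f" and gc: "continuous_on {0..L} g"
    using f g by (auto intro: has_integral_deriv_continuous)
  show "integrable (interval_measure L) (\<lambda>x. f' x * g x + g' x * f x)"
    by (intro Bochner_Integration.integrable_add integrable_mult_continuous fi gi fc gc)
  fix x assume x: "x \<in> {0..L}"
  let ?M = "interval_measure x"
  have fi': "integrable ?M f'" and gi': "integrable ?M g'"
    using integrable_interval_measure_mono[OF fi] integrable_interval_measure_mono[OF gi] x by auto
  have fc': "continuous_on {0..x} f" and gc': "continuous_on {0..x} g"
    using x by (auto intro: continuous_on_subset[OF fc] continuous_on_subset[OF gc])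
  let ?F = "\<lambda>x. \<integral>y. f' y \<partial>interval_measure x" and ?G = "\<lambda>x. \<integral>y. g' y \<partial>interval_measure x"
  have fF: "f y = f 0 + ?F y" and gG: "g y = g 0 + ?G y" if "y \<in> {0..x}" for y
  proof -
    have "y \<in> {0..L}" using that x by simp
    then show "f y = f 0 + ?F y" "g y = g 0 + ?G y"
      using f g unfolding has_integral_deriv_def by blast+
  qed
  have Ff: "?F y = f y - f 0" and Gg: "?G y = g y - g 0" if "y \<in> {0..x}" for y
    using fF[OF that] gG[OF that] by linarith+
  have 1: "(\<integral>y. f' y * g y \<partial>?M) = (\<integral>y. f' y * ?G y \<partial>?M) + g 0 * ?F x"
  proof -
    have "(\<integral>y. f' y * ?G y \<partial>?M) = (\<integral>y. f' y * g y - g 0 * f' y \<partial>?M)"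
      by (rule Bochner_Integration.integral_cong[OF refl]) (simp add: Gg right_diff_distrib mult.commute)
    then show ?thesis using integrable_mult_continuous[OF fi' gc'] fi' by simp
  qed
  have 2: "(\<integral>y. g' y * f y \<partial>?M) = (\<integral>y. ?F y * g' y \<partial>?M) + f 0 * ?G x"
  proof -
    have "(\<integral>y. ?F y * g' y \<partial>?M) = (\<integral>y. g' y * f y - f 0 * g' y \<partial>?M)"
      by (rule Bochner_Integration.integral_cong[OF refl]) (simp add: Ff algebra_simps)
    then show ?thesis using integrable_mult_continuous[OF gi' fc'] gi' by simp
  qed
  have "(\<integral>y. f' y * g y + g' y * f y \<partial>?M) = (\<integral>y. f' y * g y \<partial>?M) + (\<integral>y. g' y * f y \<partial>?M)"
    using integrable_mult_continuous[OF fi' gc'] integrable_mult_continuous[OF gi' fc'] by simp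
  also have "\<dots> = ?F x * ?G x + g 0 * ?F x + f 0 * ?G x"
    using 1 2 integral_product_rule[OF fi' gi'] by simp
  also have "\<dots> = f x * g x - f 0 * g 0"
    using fF[of x] gG[of x] x by (simp add: algebra_simps)
  finally show "f x * g x = f 0 * g 0 + (\<integral>y. f' y * g y + g' y * f y \<partial>?M)"
    by simp
qed

lemma ip_1: "ip L (\<lambda>x. 1) a b = (\<integral>x. a x * b x \<partial>interval_measure L)"
  by (simp add: ip_def)

lemma integration_by_parts_H1:
  assumes "0 < L" "f \<in> H1_space L" "g \<in> H1_space L"
  shows "ip L (\<lambda>x. 1) (wderiv L f) g + ip L (\<lambda>x. 1) f (wderiv L g) = f L * g L - f 0 * g 0"
proof -
  let ?M = "interval_measure L"
  have "has_integral_deriv L f (wderiv L f)" "has_integral_deriv L g (wderiv L g)"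
    using assms by (auto intro: has_integral_deriv_H1 wderiv_H1)
  from has_integral_derivD[OF has_integral_deriv_mult[OF this], of L]
  have "f L * g L = f 0 * g 0 + (\<integral>x. wderiv L f x * g x + wderiv L g x * f x \<partial>?M)"
    using assms(1) by simp
  also have "(\<integral>x. wderiv L f x * g x + wderiv L g x * f x \<partial>?M)
      = (\<integral>x. wderiv L f x * g x \<partial>?M) + (\<integral>x. wderiv L g x * f x \<partial>?M)"
    using assms by (intro Bochner_Integration.integral_add integrable_mult_L2 wderiv_H1 H1_space_imp_L2)
  finally show ?thesis by (simp add: ip_def mult.commute)
qed

text \<open>The product rule is applied to f g and then to x (f g). The weight vanishes at 0, so the
  trace at L is the only boundary term; differentiating the weight produces the unweighted pairing,
  which later becomes the -E in F'.\<close>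

lemma weighted_integration_by_parts_H1:
  assumes "0 < L" "f \<in> H1_space L" "g \<in> H1_space L"
  shows "ip L (\<lambda>x. x) (wderiv L f) g + ip L (\<lambda>x. x) f (wderiv L g)
    = L * (f L * g L) - ip L (\<lambda>x. 1) f g"
proof -
  let ?M = "interval_measure L"
  have "has_integral_deriv L f (wderiv L f)" "has_integral_deriv L g (wderiv L g)"
    using assms by (auto intro: has_integral_deriv_H1 wderiv_H1)
  note fg = has_integral_deriv_mult[OF this]
  have "has_integral_deriv L (\<lambda>x. x) (\<lambda>x. 1)"
    using finite_measure.integrable_const[OF finite_interval_measure, of L "1 :: real"]
    by (auto simp: has_integral_deriv_def measure_restrict_space)
  from has_integral_derivD[OF has_integral_deriv_mult[OF this fg], of L]
  have "L * (f L * g L) = (\<integral>x. 1 * (f x * g x) + (wderiv L f x * g x + wderiv L g x * f x) * x \<partial>?M)"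
    using assms(1) by simp
  also have "\<dots> = (\<integral>x. 1 * (f x * g x) + (x * (wderiv L f x * g x) + x * (f x * wderiv L g x)) \<partial>?M)"
    by (rule Bochner_Integration.integral_cong) (auto simp: algebra_simps)
  also have "\<dots> = ip L (\<lambda>x. 1) f g + (ip L (\<lambda>x. x) (wderiv L f) g + ip L (\<lambda>x. x) f (wderiv L g))"
    unfolding ip_def using assms
    by (simp only: Bochner_Integration.integral_add Bochner_Integration.integrable_add integrable_ip
        wderiv_H1 H1_space_imp_L2 continuous_on_id continuous_on_const)
  finally show ?thesis by simp
qed

subsection \<open>The Lyapunov function\<close>

lemma C0_pathD:
  assumes "C0_path X N u" "t \<ge> 0"
  shows "u t \<in> X" "((\<lambda>s. N (u s - u t)) \<longlongrightarrow> 0) (at t within {0..})"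
  using assms by (auto simp: C0_path_def)

lemma eventually_at_within_nonneg:
  "(\<And>s. s \<ge> 0 \<Longrightarrow> P s) \<Longrightarrow> \<forall>\<^sub>F s in at t within {0..}. P (s :: real)"
  by (simp add: eventually_at_filter)

lemma C0_path_L2_tendsto:
  assumes "C0_path (L2_space L) (norm_L2 L) u" "t \<ge> 0"
  shows "L2_tendsto L u (u t) (at t within {0..})"
  using C0_pathD[OF assms] C0_pathD(1)[OF assms(1)]
  by (auto simp: L2_tendsto_def fun_diff_def intro!: eventually_at_within_nonneg)

lemma C1_path_L2_tendsto:
  assumes "C1_path (L2_space L) (norm_L2 L) u u'" "t \<ge> 0"
  shows "L2_tendsto L (\<lambda>s x. (u s x - u t x) / (s - t)) (u' t) (at t within {0..})"
proof -
  have u: "u s \<in> L2_space L" and u': "u' s \<in> L2_space L" if "s \<ge> 0" for s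
    using assms that by (auto simp: C1_path_def C0_path_def)
  have "((\<lambda>s. norm_L2 L (\<lambda>x. (u s x - u t x) / (s - t) - u' t x)) \<longlongrightarrow> 0) (at t within {0..})"
    using assms unfolding C1_path_def by blast
  then show ?thesis
    using u u' assms(2) by (auto simp: L2_tendsto_def intro!: eventually_at_within_nonneg L2_space_quotient)
qed

text \<open>Being C1 in H1 is what permits the exchange of derivatives: the second limit says that
  the time derivative of v_x, taken in L2, is the space derivative of v_t.\<close>

lemma C1_path_wderiv_tendsto:
  assumes "L > 0" "C1_path (H1s_space L) (norm_H1 L) u u'" "t \<ge> 0"
  shows "L2_tendsto L (\<lambda>s. wderiv L (u s)) (wderiv L (u t)) (at t within {0..})"
    and "L2_tendsto L (\<lambda>s x. (wderiv L (u s) x - wderiv L (u t) x) / (s - t)) (wderiv L (u' t)) (at t within {0..})"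
proof -
  have u: "u s \<in> H1_space L" and u': "u' s \<in> H1_space L" if "s \<ge> 0" for s
    using assms(2) that by (auto simp: C1_path_def C0_path_def H1s_space_def)
  have l1: "((\<lambda>s. norm_H1 L (\<lambda>x. u s x - u t x)) \<longlongrightarrow> 0) (at t within {0..})"
    using C0_pathD(2)[of "H1s_space L" "norm_H1 L" u t] assms by (simp add: C1_path_def fun_diff_def)
  have l2: "((\<lambda>s. norm_H1 L (\<lambda>x. (u s x - u t x) / (s - t) - u' t x)) \<longlongrightarrow> 0) (at t within {0..})"
    using assms unfolding C1_path_def by blast
  have "((\<lambda>s. norm_L2 L (\<lambda>x. wderiv L (u s) x - wderiv L (u t) x)) \<longlongrightarrow> 0) (at t within {0..})"
    by (rule Lim_null_comparison[OF _ l1])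
       (auto intro!: eventually_at_within_nonneg norm_wderiv_diff assms u)
  then show "L2_tendsto L (\<lambda>s. wderiv L (u s)) (wderiv L (u t)) (at t within {0..})"
    using assms(3) by (auto simp: L2_tendsto_def intro!: eventually_at_within_nonneg wderiv_H1 u)
  have "((\<lambda>s. norm_L2 L (\<lambda>x. (wderiv L (u s) x - wderiv L (u t) x) / (s - t) - wderiv L (u' t) x)) \<longlongrightarrow> 0)
      (at t within {0..})"
    by (rule Lim_null_comparison[OF _ l2])
       (auto intro!: eventually_at_within_nonneg norm_wderiv_quotient assms u u')
  then show "L2_tendsto L (\<lambda>s x. (wderiv L (u s) x - wderiv L (u t) x) / (s - t)) (wderiv L (u' t)) (at t within {0..})"
    using assms(3) by (auto simp: L2_tendsto_def intro!: eventually_at_within_nonneg L2_space_quotient wderiv_H1 u u')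
qed

text \<open>Expanding \<beta> (\<gamma> v_x - p_x)^2 moves \<gamma>^2 \<beta> into the coefficient
  of v_x^2, which becomes the \<alpha> of the equations, and leaves a cross term. In this form
  limits and derivatives of pairings apply term by term.\<close>

lemma energy_eq_ip:
  assumes "v \<in> H1_space L" "p \<in> H1_space L" "w \<in> L2_space L" "q \<in> L2_space L"
  defines "I \<equiv> ip L (\<lambda>x. 1)"
  shows "energy L \<rho> \<mu> \<alpha>1 \<beta> \<gamma> (v, p, w, q) =
    1 / 2 * (\<rho> * I w w + \<mu> * I q q + (\<alpha>1 + \<gamma>\<^sup>2 * \<beta>) * I (wderiv L v) (wderiv L v)
      + \<beta> * I (wderiv L p) (wderiv L p) - 2 * \<gamma> * \<beta> * I (wderiv L v) (wderiv L p))"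
proof -
  let ?M = "interval_measure L" and ?a = "wderiv L v" and ?b = "wderiv L p"
  have L2: "?a \<in> L2_space L" "?b \<in> L2_space L" using assms wderiv_H1 by auto
  have i: "integrable ?M (\<lambda>x. w x * w x)" "integrable ?M (\<lambda>x. q x * q x)" "integrable ?M (\<lambda>x. ?a x * ?a x)"
    "integrable ?M (\<lambda>x. ?b x * ?b x)" "integrable ?M (\<lambda>x. ?a x * ?b x)"
    using assms(3,4) L2 by (auto intro: integrable_mult_L2)
  have "(\<integral>x. \<rho> * (w x)\<^sup>2 + \<mu> * (q x)\<^sup>2 + \<alpha>1 * (?a x)\<^sup>2 + \<beta> * (\<gamma> * ?a x - ?b x)\<^sup>2 \<partial>?M)
      = (\<integral>x. \<rho> * (w x * w x) + \<mu> * (q x * q x) + (\<alpha>1 + \<gamma>\<^sup>2 * \<beta>) * (?a x * ?a x)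
          + \<beta> * (?b x * ?b x) - (2 * \<gamma> * \<beta>) * (?a x * ?b x) \<partial>?M)"
    by (rule Bochner_Integration.integral_cong) (auto simp: power2_eq_square algebra_simps)
  then show ?thesis using i by (simp add: I_def ip_1)
qed

section \<open>Inequalities behind the Lyapunov function\<close>

text \<open>The hypothesis on \<open>r\<close> encodes r = |k| / sqrt (A B), the smallest possible
  factor, without roots or division. After squaring, the claim is that (A x^2 - B y^2)^2 is
  non-negative.\<close>

lemma weighted_AM_GM:
  fixes A B k r x y :: real
  assumes "A > 0" "B > 0" "r \<ge> 0" "r\<^sup>2 * A * B = k\<^sup>2"
  shows "2 * \<bar>k * (x * y)\<bar> \<le> r * (A * x\<^sup>2 + B * y\<^sup>2)"
proof (rule power2_le_imp_le)
  show "0 \<le> r * (A * x\<^sup>2 + B * y\<^sup>2)" using assms by simp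
  have "(2 * \<bar>k * (x * y)\<bar>)\<^sup>2 = 4 * (r\<^sup>2 * A * B) * x\<^sup>2 * y\<^sup>2"
    by (simp add: assms power_mult_distrib abs_mult)
  also have "\<dots> \<le> r\<^sup>2 * (A * x\<^sup>2 + B * y\<^sup>2)\<^sup>2"
  proof -
    have "0 \<le> r\<^sup>2 * (A * x\<^sup>2 - B * y\<^sup>2)\<^sup>2" by simp
    then show ?thesis by (simp add: power2_eq_square algebra_simps)
  qed
  finally show "(2 * \<bar>k * (x * y)\<bar>)\<^sup>2 \<le> (r * (A * x\<^sup>2 + B * y\<^sup>2))\<^sup>2"
    by (simp add: power_mult_distrib)
qed

text \<open>This is the origin of \<eta>. Writing b = \<gamma> a - (\<gamma> a - b) produces three
  products of quantities whose squares occur in the energy density, with factors \<open>r\<close>,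
  \<open>s\<close> and \<open>m\<close>. Collected, the squares of w, q, a and \<gamma> a - b carry
  r, m + s, r + s and m; \<eta> is the maximum of the two sums.\<close>

lemma multiplier_density_bound:
  fixes a b w q :: real
  assumes "\<rho> > 0" "\<mu> > 0" "\<beta> > 0" "\<alpha>1 > 0"
    and "\<eta> = max (sqrt (\<rho> / \<alpha>1) + sqrt (\<mu> * \<gamma>\<^sup>2 / \<alpha>1)) (sqrt (\<mu> / \<beta>) + sqrt (\<mu> * \<gamma>\<^sup>2 / \<alpha>1))"
  shows "\<bar>\<rho> * (w * a) + \<mu> * (q * b)\<bar>
    \<le> \<eta> / 2 * (\<rho> * w\<^sup>2 + \<mu> * q\<^sup>2 + \<alpha>1 * a\<^sup>2 + \<beta> * (\<gamma> * a - b)\<^sup>2)"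
proof -
  define r s m where "r = sqrt (\<rho> / \<alpha>1)" and "s = sqrt (\<mu> * \<gamma>\<^sup>2 / \<alpha>1)" and "m = sqrt (\<mu> / \<beta>)"
  have n: "r \<ge> 0" "s \<ge> 0" "m \<ge> 0" using assms by (simp_all add: r_def s_def m_def)
  have "r\<^sup>2 = \<rho> / \<alpha>1" "s\<^sup>2 = \<mu> * \<gamma>\<^sup>2 / \<alpha>1" "m\<^sup>2 = \<mu> / \<beta>"
    using assms by (simp_all add: r_def s_def m_def)
  then have sq: "r\<^sup>2 * \<rho> * \<alpha>1 = \<rho>\<^sup>2" "s\<^sup>2 * \<mu> * \<alpha>1 = (\<mu> * \<gamma>)\<^sup>2" "m\<^sup>2 * \<mu> * \<beta> = \<mu>\<^sup>2"
    using assms by (simp_all add: power2_eq_square)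
  have 1: "2 * \<bar>\<rho> * (w * a)\<bar> \<le> r * (\<rho> * w\<^sup>2 + \<alpha>1 * a\<^sup>2)"
    by (rule weighted_AM_GM) (use assms n sq in simp_all)
  have 2: "2 * \<bar>(\<mu> * \<gamma>) * (q * a)\<bar> \<le> s * (\<mu> * q\<^sup>2 + \<alpha>1 * a\<^sup>2)"
    by (rule weighted_AM_GM) (use assms n sq in simp_all)
  have 3: "2 * \<bar>\<mu> * (q * (\<gamma> * a - b))\<bar> \<le> m * (\<mu> * q\<^sup>2 + \<beta> * (\<gamma> * a - b)\<^sup>2)"
    by (rule weighted_AM_GM) (use assms n sq in simp_all)
  have e: "r + s \<le> \<eta>" "m + s \<le> \<eta>" by (simp_all add: assms(5) r_def s_def m_def)
  have "\<rho> * (w * a) + \<mu> * (q * b) = \<rho> * (w * a) + (\<mu> * \<gamma>) * (q * a) - \<mu> * (q * (\<gamma> * a - b))"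
    by (simp add: algebra_simps)
  moreover have tri: "\<bar>x + y - z\<bar> \<le> \<bar>x\<bar> + \<bar>y\<bar> + \<bar>z\<bar>" for x y z :: real
    by linarith
  ultimately have "2 * \<bar>\<rho> * (w * a) + \<mu> * (q * b)\<bar>
      \<le> 2 * \<bar>\<rho> * (w * a)\<bar> + 2 * \<bar>(\<mu> * \<gamma>) * (q * a)\<bar> + 2 * \<bar>\<mu> * (q * (\<gamma> * a - b))\<bar>"
    using tri by (simp only: mult_left_mono flip: distrib_left)
  also have "\<dots> \<le> r * (\<rho> * w\<^sup>2 + \<alpha>1 * a\<^sup>2) + s * (\<mu> * q\<^sup>2 + \<alpha>1 * a\<^sup>2)
      + m * (\<mu> * q\<^sup>2 + \<beta> * (\<gamma> * a - b)\<^sup>2)"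
    by (intro add_mono 1 2 3)
  also have "\<dots> = r * (\<rho> * w\<^sup>2) + (m + s) * (\<mu> * q\<^sup>2)
      + (r + s) * (\<alpha>1 * a\<^sup>2) + m * (\<beta> * (\<gamma> * a - b)\<^sup>2)"
    by (simp only: distrib_left distrib_right ac_simps)
  also have "\<dots> \<le> \<eta> * (\<rho> * w\<^sup>2) + \<eta> * (\<mu> * q\<^sup>2) + \<eta> * (\<alpha>1 * a\<^sup>2) + \<eta> * (\<beta> * (\<gamma> * a - b)\<^sup>2)"
    using e n assms by (intro add_mono mult_right_mono) auto
  finally show ?thesis by (simp add: distrib_left)
qed

definition multiplier :: "real \<Rightarrow> real \<Rightarrow> real \<Rightarrow> state \<Rightarrow> real" where
  "multiplier L \<rho> \<mu> = (\<lambda>(v, p, w, q).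
     \<rho> * ip L (\<lambda>x. x) w (wderiv L v) + \<mu> * ip L (\<lambda>x. x) q (wderiv L p))"

lemma energy_nonneg:
  assumes "\<rho> > 0" "\<mu> > 0" "\<beta> > 0" "\<alpha>1 > 0"
  shows "energy L \<rho> \<mu> \<alpha>1 \<beta> \<gamma> U \<ge> 0"
  using assms by (cases U) (auto intro!: Bochner_Integration.integral_nonneg)

lemma multiplier_bound:
  assumes pos: "L > 0" "\<rho> > 0" "\<mu> > 0" "\<beta> > 0" "\<alpha>1 > 0"
    and \<eta>: "\<eta> = max (sqrt (\<rho> / \<alpha>1) + sqrt (\<mu> * \<gamma>\<^sup>2 / \<alpha>1)) (sqrt (\<mu> / \<beta>) + sqrt (\<mu> * \<gamma>\<^sup>2 / \<alpha>1))"
    and sp: "v \<in> H1_space L" "p \<in> H1_space L" "w \<in> L2_space L" "q \<in> L2_space L"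
  shows "\<bar>multiplier L \<rho> \<mu> (v, p, w, q)\<bar> \<le> L * \<eta> * energy L \<rho> \<mu> \<alpha>1 \<beta> \<gamma> (v, p, w, q)"
proof -
  let ?M = "interval_measure L" and ?a = "wderiv L v" and ?b = "wderiv L p"
  let ?e = "\<lambda>x. \<rho> * (w x)\<^sup>2 + \<mu> * (q x)\<^sup>2 + \<alpha>1 * (?a x)\<^sup>2 + \<beta> * (\<gamma> * ?a x - ?b x)\<^sup>2"
  let ?f = "\<lambda>x. \<rho> * (x * (w x * ?a x)) + \<mu> * (x * (q x * ?b x))"
  have L2: "?a \<in> L2_space L" "?b \<in> L2_space L" "(\<lambda>x. \<gamma> * ?a x - ?b x) \<in> L2_space L"
    using sp wderiv_H1 L2_space_lincomb[of ?a L ?b \<gamma> "-1"] by auto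
  have ie: "integrable ?M ?e"
    using sp L2 by (simp add: L2_space_def)
  have i2: "integrable ?M (\<lambda>x. x * (w x * ?a x))" "integrable ?M (\<lambda>x. x * (q x * ?b x))"
    using sp L2 by (auto intro: integrable_ip)
  then have "multiplier L \<rho> \<mu> (v, p, w, q) = (\<integral>x. ?f x \<partial>?M)"
    by (simp add: multiplier_def ip_def)
  then have "\<bar>multiplier L \<rho> \<mu> (v, p, w, q)\<bar> \<le> (\<integral>x. \<bar>?f x\<bar> \<partial>?M)"
    by (simp only: integral_abs_bound)
  also have "\<dots> \<le> (\<integral>x. L * \<eta> / 2 * ?e x \<partial>?M)"
  proof (rule integral_mono)
    fix x assume "x \<in> space ?M"
    then have x: "0 < x" "x < L" by auto
    have "\<bar>?f x\<bar> = x * \<bar>\<rho> * (w x * ?a x) + \<mu> * (q x * ?b x)\<bar>"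
    proof -
      have "?f x = x * (\<rho> * (w x * ?a x) + \<mu> * (q x * ?b x))"
        by (simp only: distrib_left mult.left_commute)
      then show ?thesis using x by (simp add: abs_mult)
    qed
    also have "\<dots> \<le> L * (\<eta> / 2 * ?e x)"
      using x multiplier_density_bound[OF pos(2-5) \<eta>] by (intro mult_mono) auto
    finally show "\<bar>?f x\<bar> \<le> L * \<eta> / 2 * ?e x" by simp
  qed (use i2 ie in auto)
  also have "\<dots> = L * \<eta> * energy L \<rho> \<mu> \<alpha>1 \<beta> \<gamma> (v, p, w, q)"
    by simp
  finally show ?thesis .
qed

text \<open>The variable b = \<gamma> c - d diagonalises the form in c and d to \<alpha>1 c^2 +
  \<beta> b^2, and the boundary conditions become \<beta> b = \<xi>2 P and \<alpha>1 c = -(\<xi>1 V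
  + \<gamma> \<xi>2 P). The coupling of V and P sits in a single square, which Young's inequality
  separates.\<close>

lemma boundary_dissipation:
  fixes V P c d :: real
  assumes pos: "\<beta> > 0" "\<alpha>1 > 0" "\<epsilon> > 0"
    and q1: "\<rho> + (1 + \<epsilon>) * \<xi>1\<^sup>2 / \<alpha>1 \<le> 4 * \<eta> * \<xi>1"
    and q2: "\<mu> + ((1 + 1 / \<epsilon>) * \<gamma>\<^sup>2 / \<alpha>1 + 1 / \<beta>) * \<xi>2\<^sup>2 \<le> 4 * \<eta> * \<xi>2"
    and \<alpha>: "\<alpha> = \<alpha>1 + \<gamma>\<^sup>2 * \<beta>"
    and bc: "\<alpha> * c - \<gamma> * \<beta> * d = - \<xi>1 * V" "\<beta> * d - \<gamma> * \<beta> * c = - \<xi>2 * P"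
  shows "\<rho> * V\<^sup>2 + \<mu> * P\<^sup>2 + \<alpha> * c\<^sup>2 + \<beta> * d\<^sup>2 - 2 * \<gamma> * \<beta> * (c * d)
    \<le> 4 * \<eta> * (\<xi>1 * V\<^sup>2 + \<xi>2 * P\<^sup>2)"
proof -
  define b where "b = \<gamma> * c - d"
  have b: "\<beta> * b = \<xi>2 * P" using bc(2) by (simp add: b_def algebra_simps)
  have "\<alpha>1 * c + \<gamma> * (\<beta> * b) = - \<xi>1 * V"
    using bc(1) by (simp add: b_def \<alpha> algebra_simps power2_eq_square)
  then have c: "\<alpha>1 * c = - (\<xi>1 * V + \<gamma> * \<xi>2 * P)" by (simp add: b)
  have "\<alpha> * c\<^sup>2 + \<beta> * d\<^sup>2 - 2 * \<gamma> * \<beta> * (c * d) = \<alpha>1 * c\<^sup>2 + \<beta> * b\<^sup>2"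
    by (simp add: b_def \<alpha> power2_eq_square algebra_simps)
  also have "\<alpha>1 * c\<^sup>2 = (\<alpha>1 * c)\<^sup>2 / \<alpha>1"
    using pos by (simp add: power2_eq_square)
  also have "\<dots> = (\<xi>1 * V + \<gamma> * \<xi>2 * P)\<^sup>2 / \<alpha>1" by (simp only: c power2_minus)
  also have "\<beta> * b\<^sup>2 = (\<beta> * b)\<^sup>2 / \<beta>"
    using pos by (simp add: power2_eq_square)
  also have "\<dots> = (\<xi>2 * P)\<^sup>2 / \<beta>" by (simp only: b)
  finally have eq: "\<alpha> * c\<^sup>2 + \<beta> * d\<^sup>2 - 2 * \<gamma> * \<beta> * (c * d)
      = (\<xi>1 * V + \<gamma> * \<xi>2 * P)\<^sup>2 / \<alpha>1 + (\<xi>2 * P)\<^sup>2 / \<beta>" .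
  have young: "(x + y)\<^sup>2 \<le> (1 + \<epsilon>) * x\<^sup>2 + (1 + 1 / \<epsilon>) * y\<^sup>2" for x y :: real
  proof -
    have "0 \<le> (\<epsilon> * x - y)\<^sup>2 / \<epsilon>" using pos by simp
    also have "\<dots> = \<epsilon> * x\<^sup>2 - 2 * x * y + y\<^sup>2 / \<epsilon>"
      using pos by (simp add: power2_eq_square field_simps)
    finally show ?thesis by (simp add: power2_sum algebra_simps)
  qed
  have "(\<xi>1 * V + \<gamma> * \<xi>2 * P)\<^sup>2 / \<alpha>1
      \<le> ((1 + \<epsilon>) * (\<xi>1 * V)\<^sup>2 + (1 + 1 / \<epsilon>) * (\<gamma> * \<xi>2 * P)\<^sup>2) / \<alpha>1"
    using young pos by (intro divide_right_mono) auto
  also have "\<dots> = (1 + \<epsilon>) * \<xi>1\<^sup>2 / \<alpha>1 * V\<^sup>2 + (1 + 1 / \<epsilon>) * \<gamma>\<^sup>2 / \<alpha>1 * \<xi>2\<^sup>2 * P\<^sup>2"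
    by (simp add: power_mult_distrib add_divide_distrib mult.assoc)
  finally have "\<rho> * V\<^sup>2 + \<mu> * P\<^sup>2 + ((\<xi>1 * V + \<gamma> * \<xi>2 * P)\<^sup>2 / \<alpha>1 + (\<xi>2 * P)\<^sup>2 / \<beta>)
     \<le> (\<rho> + (1 + \<epsilon>) * \<xi>1\<^sup>2 / \<alpha>1) * V\<^sup>2 + (\<mu> + ((1 + 1 / \<epsilon>) * \<gamma>\<^sup>2 / \<alpha>1 + 1 / \<beta>) * \<xi>2\<^sup>2) * P\<^sup>2"
    by (simp add: power_mult_distrib distrib_right)
  also have "\<dots> \<le> (4 * \<eta> * \<xi>1) * V\<^sup>2 + (4 * \<eta> * \<xi>2) * P\<^sup>2"
    by (intro add_mono mult_right_mono q1 q2) auto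
  finally show ?thesis using eq by (simp add: algebra_simps)
qed

subsection \<open>Energy and multiplier identities\<close>

lemma ip_AE_eq:
  assumes w: "continuous_on {0..L} w"
    and L2: "e \<in> L2_space L" "c \<in> L2_space L" "d \<in> L2_space L" "g \<in> L2_space L"
    and ae: "AE x in interval_measure L. r * e x = a * c x + b * d x"
  shows "r * ip L w e g = a * ip L w c g + b * ip L w d g"
proof -
  let ?M = "interval_measure L"
  \<comment> \<open>The summand \<open>0 * e x\<close> gives the left side the shape of a linear
    combination, so the same rules serve both sides.\<close>
  have "(\<lambda>x. r * e x + 0 * e x) \<in> L2_space L" "(\<lambda>x. a * c x + b * d x) \<in> L2_space L"
    using L2 by (intro L2_space_lincomb; simp)+
  then have "integrable ?M (\<lambda>x. w x * ((r * e x + 0 * e x) * g x))"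
    "integrable ?M (\<lambda>x. w x * ((a * c x + b * d x) * g x))"
    using integrable_ip[OF w _ L2(4)] by blast+
  then have "ip L w (\<lambda>x. r * e x + 0 * e x) g = ip L w (\<lambda>x. a * c x + b * d x) g"
    unfolding ip_def using ae by (intro integral_cong_AE) auto
  then show ?thesis
    unfolding ip_lincomb_left[OF w L2(2,3,4)] ip_lincomb_left[OF w L2(1,1,4)] by simp
qed

text \<open>The letters stand for v_t, p_t, v_x, p_x, v_tt and p_tt in this order. Integration by
  parts moves the space derivative off v_x and p_x; all interior terms cancel, and the boundary
  terms at 0 vanish with \<open>a 0\<close> and \<open>b 0\<close>.\<close>

lemma energy_identity:
  assumes L: "L > 0"
    and sp: "a \<in> H1s_space L" "b \<in> H1s_space L" "c \<in> H1_space L" "d \<in> H1_space L"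
      "e \<in> L2_space L" "f \<in> L2_space L"
    and eq1: "AE x in interval_measure L. \<rho> * e x = \<alpha> * wderiv L c x + (- \<gamma> * \<beta>) * wderiv L d x"
    and eq2: "AE x in interval_measure L. \<mu> * f x = \<beta> * wderiv L d x + (- \<gamma> * \<beta>) * wderiv L c x"
  defines "I \<equiv> ip L (\<lambda>x. 1)"
  shows "\<rho> * I e a + \<mu> * I f b + \<alpha> * I (wderiv L a) c + \<beta> * I (wderiv L b) d
      - \<gamma> * \<beta> * (I (wderiv L a) d + I c (wderiv L b))
    = a L * (\<alpha> * c L - \<gamma> * \<beta> * d L) + b L * (\<beta> * d L - \<gamma> * \<beta> * c L)"
proof -
  have H: "a \<in> H1_space L" "b \<in> H1_space L" "a 0 = 0" "b 0 = 0"
    using sp by (auto simp: H1s_space_def)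
  note m = wderiv_H1(1) H1_space_imp_L2
  have 1: "\<rho> * I e a = \<alpha> * I (wderiv L c) a + (- \<gamma> * \<beta>) * I (wderiv L d) a"
    unfolding I_def using sp H m by (intro ip_AE_eq[OF _ _ _ _ _ eq1]) auto
  have 2: "\<mu> * I f b = \<beta> * I (wderiv L d) b + (- \<gamma> * \<beta>) * I (wderiv L c) b"
    unfolding I_def using sp H m by (intro ip_AE_eq[OF _ _ _ _ _ eq2]) auto
  have ibp: "I (wderiv L g) h = h L * g L - I (wderiv L h) g"
    if "h \<in> H1_space L" "g \<in> H1_space L" "h 0 = 0" for g h
    using integration_by_parts_H1[OF L that(2,1)] that(3) by (simp add: I_def ip_commute mult.commute)
  have com: "I c (wderiv L b) = I (wderiv L b) c" unfolding I_def by (rule ip_commute)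
  show ?thesis
    unfolding 1 2 com ibp[OF H(1) sp(3) H(3)] ibp[OF H(1) sp(4) H(3)] ibp[OF H(2) sp(3) H(4)] ibp[OF H(2) sp(4) H(4)]
    by (simp add: algebra_simps)
qed

text \<open>With the same reading of the letters, every weighted term has the form of x times the
  derivative of a square or of the product v_x p_x. Each integrates to half a trace term minus half
  an unweighted pairing, or the full amount for the mixed product.\<close>

lemma multiplier_identity:
  assumes L: "L > 0"
    and sp: "a \<in> H1s_space L" "b \<in> H1s_space L" "c \<in> H1_space L" "d \<in> H1_space L"
      "e \<in> L2_space L" "f \<in> L2_space L"
    and eq1: "AE x in interval_measure L. \<rho> * e x = \<alpha> * wderiv L c x + (- \<gamma> * \<beta>) * wderiv L d x"
    and eq2: "AE x in interval_measure L. \<mu> * f x = \<beta> * wderiv L d x + (- \<gamma> * \<beta>) * wderiv L c x"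
  defines "I \<equiv> ip L (\<lambda>x. 1)" and "J \<equiv> ip L (\<lambda>x. x)"
  shows "\<rho> * (J e c + J a (wderiv L a)) + \<mu> * (J f d + J b (wderiv L b))
    = L / 2 * (\<rho> * (a L)\<^sup>2 + \<mu> * (b L)\<^sup>2 + \<alpha> * (c L)\<^sup>2 + \<beta> * (d L)\<^sup>2 - 2 * \<gamma> * \<beta> * (c L * d L))
      - 1 / 2 * (\<rho> * I a a + \<mu> * I b b + \<alpha> * I c c + \<beta> * I d d - 2 * \<gamma> * \<beta> * I c d)"
proof -
  have H: "a \<in> H1_space L" "b \<in> H1_space L" using sp by (auto simp: H1s_space_def)
  note m = wderiv_H1(1) H1_space_imp_L2
  have 1: "\<rho> * J e c = \<alpha> * J (wderiv L c) c + (- \<gamma> * \<beta>) * J (wderiv L d) c"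
    unfolding J_def using sp m by (intro ip_AE_eq[OF _ _ _ _ _ eq1]) auto
  have 2: "\<mu> * J f d = \<beta> * J (wderiv L d) d + (- \<gamma> * \<beta>) * J (wderiv L c) d"
    unfolding J_def using sp m by (intro ip_AE_eq[OF _ _ _ _ _ eq2]) auto
  have com: "J g h = J h g" for g h unfolding J_def by (rule ip_commute)
  have self: "J (wderiv L g) g = 1 / 2 * (L * (g L)\<^sup>2 - I g g)" if "g \<in> H1_space L" for g
    using weighted_integration_by_parts_H1[OF L that that] com[of g "wderiv L g"]
    by (simp add: I_def J_def power2_eq_square)
  \<comment> \<open>Both equations contribute a mixed term with the coefficient -\<gamma> \<beta>,
    so only the sum of the two weighted mixed pairings matters, and that sum integrates.\<close>
  have cd: "J (wderiv L d) c = L * (c L * d L) - I c d - J (wderiv L c) d"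
    using weighted_integration_by_parts_H1[OF L sp(3,4)] com[of c "wderiv L d"]
    by (simp add: I_def J_def)
  show ?thesis
    unfolding distrib_left 1 2 com[of a] com[of b] self[OF H(1)] self[OF H(2)] self[OF sp(3)] self[OF sp(4)] cd
    by (simp add: algebra_simps)
qed

text \<open>The equations and boundary conditions hold at times t > 0, where the one-sided
  difference quotients of the paths give two-sided derivatives. The derivatives v_xx and p_xx enter
  through the equations and are removed by the two integral identities.\<close>

lemma strong_solution_derivs:
  fixes v p vt pt :: "real \<Rightarrow> real \<Rightarrow> real"
  assumes L: "L > 0" and t: "t > 0"
    and strong: "strong_solution L \<rho> \<mu> \<alpha>1 \<beta> \<gamma> \<xi>1 \<xi>2 v p vt pt"
    and \<alpha>: "\<alpha> = \<alpha>1 + \<gamma>\<^sup>2 * \<beta>"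
  defines "S \<equiv> \<lambda>t. (v t, p t, vt t, pt t)"
    and "c \<equiv> wderiv L (v t) L" and "d \<equiv> wderiv L (p t) L"
  shows "((\<lambda>t. energy L \<rho> \<mu> \<alpha>1 \<beta> \<gamma> (S t)) has_real_derivative
      - (\<xi>1 * (vt t L)\<^sup>2 + \<xi>2 * (pt t L)\<^sup>2)) (at t)" (is ?E)
    and "((\<lambda>t. multiplier L \<rho> \<mu> (S t)) has_real_derivative
      L / 2 * (\<rho> * (vt t L)\<^sup>2 + \<mu> * (pt t L)\<^sup>2 + \<alpha> * c\<^sup>2 + \<beta> * d\<^sup>2 - 2 * \<gamma> * \<beta> * (c * d))
      - energy L \<rho> \<mu> \<alpha>1 \<beta> \<gamma> (S t)) (at t)" (is ?F)
    and "\<alpha> * c - \<gamma> * \<beta> * d = - \<xi>1 * vt t L" "\<beta> * d - \<gamma> * \<beta> * c = - \<xi>2 * pt t L"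
proof -
  obtain vtt ptt where
    C0: "C0_path (H2_space L \<inter> H1s_space L) (norm_H2 L) v" "C0_path (H2_space L \<inter> H1s_space L) (norm_H2 L) p"
    and C1: "C1_path (H1s_space L) (norm_H1 L) v vt" "C1_path (H1s_space L) (norm_H1 L) p pt"
    and C2: "C1_path (L2_space L) (norm_L2 L) vt vtt" "C1_path (L2_space L) (norm_L2 L) pt ptt"
    and eqs: "\<And>t. t > 0 \<Longrightarrow> AE x in interval_measure L.
           \<rho> * vtt t x - \<alpha> * wderiv L (wderiv L (v t)) x
             + \<gamma> * \<beta> * wderiv L (wderiv L (p t)) x = 0 \<and>
           \<mu> * ptt t x - \<beta> * wderiv L (wderiv L (p t)) x
             + \<gamma> * \<beta> * wderiv L (wderiv L (v t)) x = 0"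
    and bc: "\<And>t. t > 0 \<Longrightarrow> \<alpha> * wderiv L (v t) L - \<gamma> * \<beta> * wderiv L (p t) L = - \<xi>1 * vt t L \<and>
        \<beta> * wderiv L (p t) L - \<gamma> * \<beta> * wderiv L (v t) L = - \<xi>2 * pt t L"
    using strong unfolding strong_solution_def Let_def \<alpha> by blast
  show bc': "\<alpha> * c - \<gamma> * \<beta> * d = - \<xi>1 * vt t L" "\<beta> * d - \<gamma> * \<beta> * c = - \<xi>2 * pt t L"
    using bc[OF t] by (simp_all add: c_def d_def)
  have t0: "t \<ge> 0" using t by simp
  have H2: "v s \<in> H2_space L" "p s \<in> H2_space L" if "s \<ge> 0" for s
    using C0 that by (auto simp: C0_path_def)
  then have H1: "v s \<in> H1_space L" "p s \<in> H1_space L" if "s \<ge> 0" for s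
    using that by (auto simp: H2_space_def)
  have H1s: "vt s \<in> H1s_space L" "pt s \<in> H1s_space L" if "s \<ge> 0" for s
    using C1 that by (auto simp: C1_path_def C0_path_def)
  then have L2t: "vt s \<in> L2_space L" "pt s \<in> L2_space L" if "s \<ge> 0" for s
    using that by (auto simp: H1s_space_def H1_space_def)
  have L2x: "wderiv L (v s) \<in> L2_space L" "wderiv L (p s) \<in> L2_space L" if "s \<ge> 0" for s
    using H1[OF that] by (auto intro: wderiv_H1)
  have L2tt: "vtt t \<in> L2_space L" "ptt t \<in> L2_space L"
    using C2 t0 by (auto simp: C1_path_def C0_path_def)
  have C2': "C0_path (L2_space L) (norm_L2 L) vt" "C0_path (L2_space L) (norm_L2 L) pt"
    using C2 by (simp_all add: C1_path_def)
  note tend = C0_path_L2_tendsto[OF C2'(1) t0] C0_path_L2_tendsto[OF C2'(2) t0]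
    C1_path_L2_tendsto[OF C2(1) t0] C1_path_L2_tendsto[OF C2(2) t0]
    C1_path_wderiv_tendsto[OF L C1(1) t0] C1_path_wderiv_tendsto[OF L C1(2) t0]
  have eq1: "AE x in interval_measure L. \<rho> * vtt t x =
      \<alpha> * wderiv L (wderiv L (v t)) x + (- \<gamma> * \<beta>) * wderiv L (wderiv L (p t)) x"
    using eqs[OF t] by eventually_elim simp
  have eq2: "AE x in interval_measure L. \<mu> * ptt t x =
      \<beta> * wderiv L (wderiv L (p t)) x + (- \<gamma> * \<beta>) * wderiv L (wderiv L (v t)) x"
    using eqs[OF t] by eventually_elim simp
  have Hx: "wderiv L (v t) \<in> H1_space L" "wderiv L (p t) \<in> H1_space L"
    using H2[OF t0] by (auto intro: wderiv_H2)
  define I where "I = ip L (\<lambda>x. 1)"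
  define J where "J = ip L (\<lambda>x. x)"
  have DI: "((\<lambda>s. I (a s) (b s)) has_real_derivative I a' (b t) + I (a t) b') (at t)"
    and DJ: "((\<lambda>s. J (a s) (b s)) has_real_derivative J a' (b t) + J (a t) b') (at t)"
    if "\<And>s. s \<ge> 0 \<Longrightarrow> a s \<in> L2_space L" "\<And>s. s \<ge> 0 \<Longrightarrow> b s \<in> L2_space L"
      "L2_tendsto L b (b t) (at t within {0..})"
      "L2_tendsto L (\<lambda>s x. (a s x - a t x) / (s - t)) a' (at t within {0..})"
      "L2_tendsto L (\<lambda>s x. (b s x - b t x) / (s - t)) b' (at t within {0..})" for a b a' b'
    unfolding I_def J_def using that t
    by (auto intro!: has_field_derivative_ip continuous_on_const continuous_on_id)
  have Icom: "I a b = I b a" for a b unfolding I_def by (rule ip_commute)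
  let ?vx = "\<lambda>s. wderiv L (v s)" and ?px = "\<lambda>s. wderiv L (p s)"
  let ?Q = "\<lambda>s. 1 / 2 * (\<rho> * I (vt s) (vt s) + \<mu> * I (pt s) (pt s) + \<alpha> * I (?vx s) (?vx s)
      + \<beta> * I (?px s) (?px s) - 2 * \<gamma> * \<beta> * I (?vx s) (?px s))"
  have EQ: "energy L \<rho> \<mu> \<alpha>1 \<beta> \<gamma> (S s) = ?Q s" if "s \<ge> 0" for s
    unfolding S_def I_def \<alpha> using H1[OF that] L2t[OF that] by (rule energy_eq_ip)
  \<comment> \<open>The pairing formula for the energy is available at times s \<ge> 0, so it is
    transferred through a neighbourhood of t inside the positive half-line.\<close>
  have EQ_near: "\<forall>\<^sub>F s in nhds t. ?Q s = energy L \<rho> \<mu> \<alpha>1 \<beta> \<gamma> (S s)"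
    using eventually_nhds_in_open[of "{0<..}" t] t EQ by (auto elim!: eventually_mono)
  have "(?Q has_real_derivative
      1 / 2 * (\<rho> * (I (vtt t) (vt t) + I (vt t) (vtt t)) + \<mu> * (I (ptt t) (pt t) + I (pt t) (ptt t))
        + \<alpha> * (I (wderiv L (vt t)) (?vx t) + I (?vx t) (wderiv L (vt t)))
        + \<beta> * (I (wderiv L (pt t)) (?px t) + I (?px t) (wderiv L (pt t)))
        - 2 * \<gamma> * \<beta> * (I (wderiv L (vt t)) (?px t) + I (?vx t) (wderiv L (pt t))))) (at t)"
    by (intro DERIV_cmult DERIV_add DERIV_diff DI L2t L2x tend)
  also have "1 / 2 * (\<rho> * (I (vtt t) (vt t) + I (vt t) (vtt t)) + \<mu> * (I (ptt t) (pt t) + I (pt t) (ptt t))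
        + \<alpha> * (I (wderiv L (vt t)) (?vx t) + I (?vx t) (wderiv L (vt t)))
        + \<beta> * (I (wderiv L (pt t)) (?px t) + I (?px t) (wderiv L (pt t)))
        - 2 * \<gamma> * \<beta> * (I (wderiv L (vt t)) (?px t) + I (?vx t) (wderiv L (pt t))))
      = \<rho> * I (vtt t) (vt t) + \<mu> * I (ptt t) (pt t) + \<alpha> * I (wderiv L (vt t)) (?vx t)
        + \<beta> * I (wderiv L (pt t)) (?px t)
        - \<gamma> * \<beta> * (I (wderiv L (vt t)) (?px t) + I (?vx t) (wderiv L (pt t)))"
    unfolding Icom[of "vt t" "vtt t"] Icom[of "pt t" "ptt t"] Icom[of "?vx t" "wderiv L (vt t)"]
      Icom[of "?px t" "wderiv L (pt t)"] by (simp add: algebra_simps)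
  also have "\<dots> = vt t L * (\<alpha> * ?vx t L - \<gamma> * \<beta> * ?px t L) + pt t L * (\<beta> * ?px t L - \<gamma> * \<beta> * ?vx t L)"
    unfolding I_def by (rule energy_identity[OF L H1s[OF t0] Hx L2tt eq1 eq2])
  also have "\<dots> = - (\<xi>1 * (vt t L)\<^sup>2 + \<xi>2 * (pt t L)\<^sup>2)"
    using bc' unfolding c_def d_def by (simp add: power2_eq_square)
  finally show ?E
    unfolding DERIV_cong_ev[OF refl EQ_near refl] .
  have "((\<lambda>s. \<rho> * J (vt s) (?vx s) + \<mu> * J (pt s) (?px s)) has_real_derivative
      \<rho> * (J (vtt t) (?vx t) + J (vt t) (wderiv L (vt t))) + \<mu> * (J (ptt t) (?px t) + J (pt t) (wderiv L (pt t)))) (at t)"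
    by (intro DERIV_cmult DERIV_add DJ L2t L2x tend)
  also have "\<rho> * (J (vtt t) (?vx t) + J (vt t) (wderiv L (vt t))) + \<mu> * (J (ptt t) (?px t) + J (pt t) (wderiv L (pt t)))
      = L / 2 * (\<rho> * (vt t L)\<^sup>2 + \<mu> * (pt t L)\<^sup>2 + \<alpha> * c\<^sup>2 + \<beta> * d\<^sup>2 - 2 * \<gamma> * \<beta> * (c * d)) - ?Q t"
    unfolding I_def J_def c_def d_def by (rule multiplier_identity[OF L H1s[OF t0] Hx L2tt eq1 eq2])
  finally show ?F
    unfolding EQ[OF t0] by (simp add: S_def multiplier_def J_def)
qed

subsection \<open>Exponential decay\<close>

lemma tendsto_energy:
  assumes "\<forall>\<^sub>F s in F. v s \<in> H1_space L" "\<forall>\<^sub>F s in F. p s \<in> H1_space L"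
    and "v0 \<in> H1_space L" "p0 \<in> H1_space L"
    and v: "L2_tendsto L (\<lambda>s. wderiv L (v s)) (wderiv L v0) F"
    and p: "L2_tendsto L (\<lambda>s. wderiv L (p s)) (wderiv L p0) F"
    and w: "L2_tendsto L w w0 F" and q: "L2_tendsto L q q0 F"
  shows "((\<lambda>s. energy L \<rho> \<mu> \<alpha>1 \<beta> \<gamma> (v s, p s, w s, q s)) \<longlongrightarrow> energy L \<rho> \<mu> \<alpha>1 \<beta> \<gamma> (v0, p0, w0, q0)) F"
proof -
  let ?I = "ip L (\<lambda>x. 1)"
  let ?Q = "\<lambda>v p w q. 1 / 2 * (\<rho> * ?I w w + \<mu> * ?I q q + (\<alpha>1 + \<gamma>\<^sup>2 * \<beta>) * ?I (wderiv L v) (wderiv L v)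
      + \<beta> * ?I (wderiv L p) (wderiv L p) - 2 * \<gamma> * \<beta> * ?I (wderiv L v) (wderiv L p))"
  have "((\<lambda>s. ?Q (v s) (p s) (w s) (q s)) \<longlongrightarrow> ?Q v0 p0 w0 q0) F"
    by (intro tendsto_mult tendsto_add tendsto_diff tendsto_const tendsto_ip continuous_on_const v p w q)
  moreover have "?Q v0 p0 w0 q0 = energy L \<rho> \<mu> \<alpha>1 \<beta> \<gamma> (v0, p0, w0, q0)"
    using assms by (intro energy_eq_ip[symmetric]) (auto simp: L2_tendsto_def)
  moreover have "\<forall>\<^sub>F s in F. v s \<in> H1_space L \<and> p s \<in> H1_space L \<and> w s \<in> L2_space L \<and> q s \<in> L2_space L"
    using assms by (simp add: eventually_conj L2_tendsto_def)
  then have "\<forall>\<^sub>F s in F. ?Q (v s) (p s) (w s) (q s) = energy L \<rho> \<mu> \<alpha>1 \<beta> \<gamma> (v s, p s, w s, q s)"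
    by (rule eventually_mono) (use energy_eq_ip in metis)
  ultimately show ?thesis by (simp only: Lim_transform_eventually)
qed

lemma tendsto_multiplier:
  assumes v: "L2_tendsto L (\<lambda>s. wderiv L (v s)) (wderiv L v0) F"
    and p: "L2_tendsto L (\<lambda>s. wderiv L (p s)) (wderiv L p0) F"
    and w: "L2_tendsto L w w0 F" and q: "L2_tendsto L q q0 F"
  shows "((\<lambda>s. multiplier L \<rho> \<mu> (v s, p s, w s, q s)) \<longlongrightarrow> multiplier L \<rho> \<mu> (v0, p0, w0, q0)) F"
  unfolding multiplier_def prod.case
  by (intro tendsto_mult tendsto_add tendsto_const tendsto_ip continuous_on_id v p w q)

text \<open>Gronwall's argument: V s exp (k s) is non-increasing for k = \<delta>/2, and the
  equivalence of V and E is used once at each end of [0,t].\<close>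

lemma strong_solution_decay:
  fixes v p vt pt :: "real \<Rightarrow> real \<Rightarrow> real"
  assumes pos: "L > 0" "\<rho> > 0" "\<mu> > 0" "\<beta> > 0" "\<alpha>1 > 0" "\<epsilon> > 0"
    and \<eta>: "\<eta> = max (sqrt (\<rho> / \<alpha>1) + sqrt (\<mu> * \<gamma>\<^sup>2 / \<alpha>1)) (sqrt (\<mu> / \<beta>) + sqrt (\<mu> * \<gamma>\<^sup>2 / \<alpha>1))"
    and q1: "\<rho> + (1 + \<epsilon>) * \<xi>1\<^sup>2 / \<alpha>1 \<le> 4 * \<eta> * \<xi>1"
    and q2: "\<mu> + ((1 + 1 / \<epsilon>) * \<gamma>\<^sup>2 / \<alpha>1 + 1 / \<beta>) * \<xi>2\<^sup>2 \<le> 4 * \<eta> * \<xi>2"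
    and strong: "strong_solution L \<rho> \<mu> \<alpha>1 \<beta> \<gamma> \<xi>1 \<xi>2 v p vt pt"
    and t: "t > 0"
  shows "energy L \<rho> \<mu> \<alpha>1 \<beta> \<gamma> (v t, p t, vt t, pt t)
    \<le> 3 * energy L \<rho> \<mu> \<alpha>1 \<beta> \<gamma> (v 0, p 0, vt 0, pt 0) * exp (- (1 / (4 * \<eta> * L)) * t)"
proof -
  define S where "S s = (v s, p s, vt s, pt s)" for s
  define E where "E s = energy L \<rho> \<mu> \<alpha>1 \<beta> \<gamma> (S s)" for s
  define F where "F s = multiplier L \<rho> \<mu> (S s)" for s
  define \<delta> where "\<delta> = 1 / (2 * \<eta> * L)"
  define V where "V s = E s + \<delta> * F s" for s
  have "sqrt (\<mu> / \<beta>) > 0" "sqrt (\<mu> * \<gamma>\<^sup>2 / \<alpha>1) \<ge> 0" using pos by simp_all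
  moreover have "sqrt (\<mu> / \<beta>) + sqrt (\<mu> * \<gamma>\<^sup>2 / \<alpha>1) \<le> \<eta>" by (simp add: \<eta>)
  ultimately have "\<eta> > 0" by linarith
  then have "\<delta> > 0" using pos by (simp add: \<delta>_def)
  have \<delta>L: "\<delta> * (L * \<eta>) = 1 / 2" using \<open>\<eta> > 0\<close> pos by (simp add: \<delta>_def)
  have c: "C1_path (H1s_space L) (norm_H1 L) v vt" "C1_path (H1s_space L) (norm_H1 L) p pt"
    "C0_path (L2_space L) (norm_L2 L) vt" "C0_path (L2_space L) (norm_L2 L) pt"
    using strong by (auto simp: strong_solution_def Let_def C1_path_def)
  have H1: "v s \<in> H1_space L" "p s \<in> H1_space L" "vt s \<in> L2_space L" "pt s \<in> L2_space L" if "s \<ge> 0" for s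
    using c that by (auto simp: C1_path_def C0_path_def H1s_space_def)
  have E0: "E s \<ge> 0" for s unfolding E_def using pos by (intro energy_nonneg)
  have F: "\<bar>\<delta> * F s\<bar> \<le> 1 / 2 * E s" if "s \<ge> 0" for s
  proof -
    have "\<bar>F s\<bar> \<le> L * \<eta> * E s"
      unfolding F_def E_def S_def by (rule multiplier_bound[OF pos(1-5) \<eta> H1[OF that]])
    then have "\<delta> * \<bar>F s\<bar> \<le> \<delta> * (L * \<eta> * E s)" using \<open>\<delta> > 0\<close> by (intro mult_left_mono) auto
    also have "\<dots> = 1 / 2 * E s" using \<delta>L by (simp add: mult.assoc[symmetric])
    finally show ?thesis using \<open>\<delta> > 0\<close> by (simp add: abs_mult)
  qed
  have V: "1 / 2 * E s \<le> V s" "V s \<le> 3 / 2 * E s" if "s \<ge> 0" for s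
    using F[OF that] by (auto simp: V_def)
  \<comment> \<open>The derivative of V is known at positive times; continuity up to 0 lets the
    estimate start from the initial data.\<close>
  have cont: "continuous_on {0..} V"
    unfolding continuous_on_def
  proof
    fix s :: real assume "s \<in> {0..}"
    then have s: "s \<ge> 0" by simp
    note tend = C1_path_wderiv_tendsto(1)[OF pos(1) c(1) s] C1_path_wderiv_tendsto(1)[OF pos(1) c(2) s]
      C0_path_L2_tendsto[OF c(3) s] C0_path_L2_tendsto[OF c(4) s]
    show "(V \<longlongrightarrow> V s) (at s within {0..})"
      unfolding V_def E_def F_def S_def
      by (intro tendsto_add tendsto_mult tendsto_const tendsto_energy tendsto_multiplier tend
          eventually_at_within_nonneg H1 s)
  qed
  define k where "k = 1 / (4 * \<eta> * L)"
  have k: "k = \<delta> / 2" by (simp add: k_def \<delta>_def)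
  have "V t * exp (k * t) \<le> V 0 * exp (k * 0)"
  proof (rule DERIV_nonpos_imp_decreasing_open[where f = "\<lambda>s. V s * exp (k * s)" and a = 0 and b = t])
    show "0 \<le> t" using t by simp
    show "continuous_on {0..t} (\<lambda>s. V s * exp (k * s))"
      by (intro continuous_intros continuous_on_subset[OF cont]) auto
    fix s assume s: "0 < s" "s < t"
    define \<alpha> where "\<alpha> = \<alpha>1 + \<gamma>\<^sup>2 * \<beta>"
    note D = strong_solution_derivs[OF pos(1) s(1) strong \<alpha>_def]
    let ?c = "wderiv L (v s) L" and ?d = "wderiv L (p s) L"
    let ?X = "\<rho> * (vt s L)\<^sup>2 + \<mu> * (pt s L)\<^sup>2 + \<alpha> * ?c\<^sup>2 + \<beta> * ?d\<^sup>2 - 2 * \<gamma> * \<beta> * (?c * ?d)"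
    let ?Y = "\<xi>1 * (vt s L)\<^sup>2 + \<xi>2 * (pt s L)\<^sup>2"
    let ?V' = "- ?Y + \<delta> * (L / 2 * ?X - E s)"
    have "?X \<le> 4 * \<eta> * ?Y"
      by (rule boundary_dissipation[OF pos(4,5,6) q1 q2 \<alpha>_def D(3,4)])
    then have "(\<delta> * (L / 2)) * ?X \<le> (\<delta> * (L / 2)) * (4 * \<eta> * ?Y)"
      using \<open>\<delta> > 0\<close> pos by (intro mult_left_mono) auto
    \<comment> \<open>Here the choice of \<delta> pays off: the boundary part of the multiplier is
      absorbed by the dissipation \<open>?Y\<close>.\<close>
    also have "(\<delta> * (L / 2)) * (4 * \<eta> * ?Y) = ?Y"
      using \<open>\<eta> > 0\<close> pos by (simp add: \<delta>_def)
    finally have V': "?V' \<le> - (\<delta> * E s)" by (simp add: right_diff_distrib mult.assoc)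
    have "(V has_real_derivative ?V') (at s)"
      unfolding V_def E_def F_def S_def by (intro DERIV_add DERIV_cmult D(1,2))
    then have "((\<lambda>s. V s * exp (k * s)) has_real_derivative (?V' + k * V s) * exp (k * s)) (at s)"
      by (auto intro!: derivative_eq_intros simp: algebra_simps)
    \<comment> \<open>Since k = \<delta>/2, the upper bound on V costs 3/4 of the gain \<delta> E
      and leaves a non-positive rest.\<close>
    moreover have "k * V s \<le> k * (3 / 2 * E s)"
      using V(2)[of s] s k \<open>\<delta> > 0\<close> by (intro mult_left_mono) auto
    then have "?V' + k * V s \<le> - (\<delta> * E s) + 3 / 4 * (\<delta> * E s)"
      using V' by (simp add: k)
    moreover have "\<delta> * E s \<ge> 0" using E0 \<open>\<delta> > 0\<close> by simp
    ultimately show "\<exists>y. ((\<lambda>s. V s * exp (k * s)) has_real_derivative y) (at s) \<and> y \<le> 0"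
      by (intro exI[of _ "(?V' + k * V s) * exp (k * s)"] conjI mult_nonpos_nonneg) auto
  qed
  then have "V t * exp (k * t) \<le> 3 / 2 * E 0" using V(2)[of 0] by simp
  moreover have "1 / 2 * E t * exp (k * t) \<le> V t * exp (k * t)"
    using V(1)[of t] t by (intro mult_right_mono) auto
  ultimately have "E t * exp (k * t) \<le> 3 * E 0" by linarith
  then have "E t * exp (k * t) * exp (- k * t) \<le> 3 * E 0 * exp (- k * t)"
    by (intro mult_right_mono) auto
  then show ?thesis
    by (simp add: E_def S_def k_def mult.assoc flip: exp_add)
qed

section \<open>Passage to weak solutions\<close>

lemma state_norm_bounds:
  "norm_H1 L v \<le> state_norm L (v, p, w, q)" "norm_H1 L p \<le> state_norm L (v, p, w, q)"
  "norm_L2 L w \<le> state_norm L (v, p, w, q)" "norm_L2 L q \<le> state_norm L (v, p, w, q)"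
  by (simp_all add: real_le_rsqrt)

lemma tendsto_energy_state:
  assumes L: "L > 0" and U: "U \<in> state_space L"
    and S: "\<And>n :: nat. v n \<in> H1_space L \<and> p n \<in> H1_space L \<and> w n \<in> L2_space L \<and> q n \<in> L2_space L"
    and lim: "(\<lambda>n. state_norm L ((v n, p n, w n, q n) - U)) \<longlonglongrightarrow> 0"
  shows "(\<lambda>n. energy L \<rho> \<mu> \<alpha>1 \<beta> \<gamma> (v n, p n, w n, q n)) \<longlonglongrightarrow> energy L \<rho> \<mu> \<alpha>1 \<beta> \<gamma> U"
proof -
  obtain v0 p0 w0 q0 where U_eq: "U = (v0, p0, w0, q0)" by (cases U)
  have U0: "v0 \<in> H1_space L" "p0 \<in> H1_space L" "w0 \<in> L2_space L" "q0 \<in> L2_space L"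
    using U by (auto simp: U_eq state_space_def H1s_space_def)
  have lim': "(\<lambda>n. state_norm L (\<lambda>x. v n x - v0 x, \<lambda>x. p n x - p0 x, \<lambda>x. w n x - w0 x, \<lambda>x. q n x - q0 x)) \<longlonglongrightarrow> 0"
    using lim by (simp add: U_eq fun_diff_def del: state_norm.simps)
  have wd: "L2_tendsto L (\<lambda>n. wderiv L (z n)) (wderiv L z0) sequentially"
    if "\<And>n. z n \<in> H1_space L" "z0 \<in> H1_space L"
      "\<And>n. norm_H1 L (\<lambda>x. z n x - z0 x)
         \<le> state_norm L (\<lambda>x. v n x - v0 x, \<lambda>x. p n x - p0 x, \<lambda>x. w n x - w0 x, \<lambda>x. q n x - q0 x)" for z z0
  proof -
    have "(\<lambda>n. norm_L2 L (\<lambda>x. wderiv L (z n) x - wderiv L z0 x)) \<longlonglongrightarrow> 0"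
    proof (rule Lim_null_comparison[OF always_eventually lim'], rule allI)
      fix n
      show "norm (norm_L2 L (\<lambda>x. wderiv L (z n) x - wderiv L z0 x))
         \<le> state_norm L (\<lambda>x. v n x - v0 x, \<lambda>x. p n x - p0 x, \<lambda>x. w n x - w0 x, \<lambda>x. q n x - q0 x)"
        using norm_wderiv_diff[OF L that(1,2), of n] that(3)[of n] by (simp del: state_norm.simps)
    qed
    then show ?thesis using that wderiv_H1 by (simp add: L2_tendsto_def)
  qed
  have l2: "L2_tendsto L z z0 sequentially"
    if "\<And>n. z n \<in> L2_space L" "z0 \<in> L2_space L"
      "\<And>n. norm_L2 L (\<lambda>x. z n x - z0 x)
         \<le> state_norm L (\<lambda>x. v n x - v0 x, \<lambda>x. p n x - p0 x, \<lambda>x. w n x - w0 x, \<lambda>x. q n x - q0 x)" for z z0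
  proof -
    have "(\<lambda>n. norm_L2 L (\<lambda>x. z n x - z0 x)) \<longlonglongrightarrow> 0"
      by (rule Lim_null_comparison[OF always_eventually lim']) (use that(3) in \<open>simp del: state_norm.simps\<close>)
    then show ?thesis using that by (simp add: L2_tendsto_def)
  qed
  show ?thesis unfolding U_eq
    using S U0 by (intro tendsto_energy wd l2 state_norm_bounds always_eventually) blast+
qed

text \<open>The estimate compares two times, so one approximating sequence must converge at both 0
  and t. The definition with T = t provides it; the energy is continuous in the state norm, and the
  inequality survives the limit.\<close>

lemma weak_solution_decay:
  assumes L: "L > 0"
    and decay: "\<And>v p vt pt t. strong_solution L \<rho> \<mu> \<alpha>1 \<beta> \<gamma> \<xi>1 \<xi>2 v p vt pt \<Longrightarrow> t > 0 \<Longrightarrow>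
        energy L \<rho> \<mu> \<alpha>1 \<beta> \<gamma> (v t, p t, vt t, pt t)
          \<le> C * energy L \<rho> \<mu> \<alpha>1 \<beta> \<gamma> (v 0, p 0, vt 0, pt 0) * exp (- k * t)"
    and weak: "weak_solution L \<rho> \<mu> \<alpha>1 \<beta> \<gamma> \<xi>1 \<xi>2 U0 U" and t: "t > 0"
  shows "energy L \<rho> \<mu> \<alpha>1 \<beta> \<gamma> (U t) \<le> C * energy L \<rho> \<mu> \<alpha>1 \<beta> \<gamma> (U 0) * exp (- k * t)"
proof -
  obtain v p vt pt :: "nat \<Rightarrow> real \<Rightarrow> real \<Rightarrow> real" where
    st: "\<And>n. strong_solution L \<rho> \<mu> \<alpha>1 \<beta> \<gamma> \<xi>1 \<xi>2 (v n) (p n) (vt n) (pt n)"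
    and ul: "uniform_limit {0..t}
          (\<lambda>n s. state_norm L ((v n s, p n s, vt n s, pt n s) - U s)) (\<lambda>s. 0) sequentially"
    using weak t unfolding weak_solution_def by blast
  have U: "U s \<in> state_space L" if "s \<ge> 0" for s
    using weak that by (auto simp: weak_solution_def C0_path_def)
  have sp: "v n s \<in> H1_space L \<and> p n s \<in> H1_space L \<and> vt n s \<in> L2_space L \<and> pt n s \<in> L2_space L"
    if "s \<ge> 0" for n s
    using st[of n] that by (auto simp: strong_solution_def Let_def C1_path_def C0_path_def H1s_space_def)
  have lim: "(\<lambda>n. energy L \<rho> \<mu> \<alpha>1 \<beta> \<gamma> (v n s, p n s, vt n s, pt n s)) \<longlonglongrightarrow> energy L \<rho> \<mu> \<alpha>1 \<beta> \<gamma> (U s)"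
    if "s \<in> {0..t}" for s
    using that by (intro tendsto_energy_state[OF L U sp] tendsto_uniform_limitI[OF ul]) auto
  show ?thesis
  proof (rule LIMSEQ_le)
    show "(\<lambda>n. energy L \<rho> \<mu> \<alpha>1 \<beta> \<gamma> (v n t, p n t, vt n t, pt n t)) \<longlonglongrightarrow> energy L \<rho> \<mu> \<alpha>1 \<beta> \<gamma> (U t)"
      using t by (intro lim) simp
    show "(\<lambda>n. C * energy L \<rho> \<mu> \<alpha>1 \<beta> \<gamma> (v n 0, p n 0, vt n 0, pt n 0) * exp (- k * t))
        \<longlonglongrightarrow> C * energy L \<rho> \<mu> \<alpha>1 \<beta> \<gamma> (U 0) * exp (- k * t)"
      using t by (intro tendsto_mult tendsto_const lim) simp
    show "\<exists>N. \<forall>n\<ge>N. energy L \<rho> \<mu> \<alpha>1 \<beta> \<gamma> (v n t, p n t, vt n t, pt n t)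
        \<le> C * energy L \<rho> \<mu> \<alpha>1 \<beta> \<gamma> (v n 0, p n 0, vt n 0, pt n 0) * exp (- k * t)"
      using decay[OF st t] by blast
  qed
qed

section \<open>Feedback gains between the roots\<close>

text \<open>Completing the square: the bounds say |A x - B| < sqrt (B^2 - A C). The mere presence of
  x makes this root positive, and as \<open>sqrt\<close> is negative at negative arguments, the
  radicand is positive.\<close>

lemma between_quadratic_roots:
  fixes A B C x :: real
  assumes "A > 0" "(B - sqrt (B\<^sup>2 - A * C)) / A < x" "x < (B + sqrt (B\<^sup>2 - A * C)) / A"
  shows "A * x\<^sup>2 + C < 2 * B * x" "B\<^sup>2 - A * C > 0"
proof -
  let ?r = "sqrt (B\<^sup>2 - A * C)"
  have x: "B - ?r < A * x" "A * x < B + ?r"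
    using assms by (simp_all add: field_simps)
  then have "?r > 0" by linarith
  then show D: "B\<^sup>2 - A * C > 0" by simp
  have "\<bar>A * x - B\<bar> < ?r" using x by linarith
  then have "\<bar>A * x - B\<bar>\<^sup>2 < ?r\<^sup>2" by (intro power_strict_mono) auto
  then have "(A * x - B)\<^sup>2 < B\<^sup>2 - A * C" using D by simp
  then have "A * (A * x\<^sup>2 + C) < A * (2 * B * x)" by (simp add: power2_eq_square algebra_simps)
  then show "A * x\<^sup>2 + C < 2 * B * x" using assms(1) by simp
qed

text \<open>As A C \<ge> 0, the root of the discriminant is at most B.\<close>

lemma quadratic_roots_nonneg:
  fixes A B C :: real
  assumes "A > 0" "B \<ge> 0" "C \<ge> 0" "B\<^sup>2 - A * C > 0"
  shows "0 \<le> (B - sqrt (B\<^sup>2 - A * C)) / A" "0 \<le> (B + sqrt (B\<^sup>2 - A * C)) / A"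
proof -
  have "sqrt (B\<^sup>2 - A * C) \<le> sqrt (B\<^sup>2)" using assms by (intro real_sqrt_le_mono) simp
  then show "0 \<le> (B - sqrt (B\<^sup>2 - A * C)) / A" using assms by simp
  show "0 \<le> (B + sqrt (B\<^sup>2 - A * C)) / A" using assms by simp
qed

theorem theorem3:
  fixes L \<rho> \<mu> \<beta> \<alpha>1 \<gamma> \<alpha> \<eta> \<epsilon> c1m c1p c2m c2p \<xi>1 \<xi>2 \<delta> \<sigma>max M :: real
    and \<sigma> :: "real \<Rightarrow> real"
  assumes "L > 0" "\<rho> > 0" "\<mu> > 0" "\<beta> > 0" "\<alpha>1 > 0"
    and "\<alpha> = \<alpha>1 + \<gamma>\<^sup>2 * \<beta>"
    and "\<eta> = max (sqrt (\<rho> / \<alpha>1) + sqrt (\<mu> * \<gamma>\<^sup>2 / \<alpha>1)) (sqrt (\<mu> / \<beta>) + sqrt (\<mu> * \<gamma>\<^sup>2 / \<alpha>1))"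
    and "\<beta> * \<gamma>\<^sup>2 * \<mu> / (4 * \<alpha>1 * \<beta> * \<eta>\<^sup>2 - \<alpha> * \<mu>) < \<epsilon>"
    and "\<epsilon> < (4 * \<alpha>1 * \<eta>\<^sup>2 - \<rho>) / \<rho>"
    and "c1m = (2 * \<alpha>1 * \<eta> - sqrt (4 * \<alpha>1\<^sup>2 * \<eta>\<^sup>2 - (1 + \<epsilon>) * \<rho> * \<alpha>1)) / (1 + \<epsilon>)"
    and "c1p = (2 * \<alpha>1 * \<eta> + sqrt (4 * \<alpha>1\<^sup>2 * \<eta>\<^sup>2 - (1 + \<epsilon>) * \<rho> * \<alpha>1)) / (1 + \<epsilon>)"
    and "c2m = (2 * \<epsilon> * \<alpha>1 * \<beta> * \<eta>
                  - sqrt (4 * (\<epsilon> * \<alpha>1 * \<beta> * \<eta>)\<^sup>2 - (\<epsilon> * \<alpha> + \<beta> * \<gamma>\<^sup>2) * \<epsilon> * \<mu> * \<alpha>1 * \<beta>))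
               / (\<epsilon> * \<alpha> + \<beta> * \<gamma>\<^sup>2)"
    and "c2p = (2 * \<epsilon> * \<alpha>1 * \<beta> * \<eta>
                  + sqrt (4 * (\<epsilon> * \<alpha>1 * \<beta> * \<eta>)\<^sup>2 - (\<epsilon> * \<alpha> + \<beta> * \<gamma>\<^sup>2) * \<epsilon> * \<mu> * \<alpha>1 * \<beta>))
               / (\<epsilon> * \<alpha> + \<beta> * \<gamma>\<^sup>2)"
    and "\<xi>1 \<in> {c1m<..<c1p}" and "\<xi>2 \<in> {c2m<..<c2p}"
    and "\<sigma> = (\<lambda>d. d * (1 - d * L * \<eta>))"
    and "\<sigma>max = 1 / (4 * \<eta> * L)"
    and "\<delta> = 1 / (2 * \<eta> * L)"
    and "M = (1 + \<delta> * L * \<eta>) / (1 - \<delta> * L * \<eta>)"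
  shows "0 \<le> c1m \<and> 0 \<le> c1p \<and> 0 \<le> c2m \<and> 0 \<le> c2p \<and>
         (\<forall>d. \<sigma> d \<le> \<sigma>max) \<and> \<sigma> \<delta> = \<sigma>max \<and> M = 3 \<and>
         (\<forall>U0\<in>state_space L. \<forall>U. weak_solution L \<rho> \<mu> \<alpha>1 \<beta> \<gamma> \<xi>1 \<xi>2 U0 U \<longrightarrow>
            (\<forall>t>0. energy L \<rho> \<mu> \<alpha>1 \<beta> \<gamma> (U t)
                     \<le> M * energy L \<rho> \<mu> \<alpha>1 \<beta> \<gamma> (U 0) * exp (- \<sigma>max * t)))"
proof -
  note pos = assms(1-5)
  note \<alpha> = assms(6) and \<eta> = assms(7)
  let ?s = "sqrt (\<mu> * \<gamma>\<^sup>2 / \<alpha>1)" and ?m = "sqrt (\<mu> / \<beta>)"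
  have ms: "?m > 0" "?s \<ge> 0" using pos by simp_all
  have \<eta>ge: "?m + ?s \<le> \<eta>" by (simp add: \<eta>)
  then have "\<eta> > 0" using ms by linarith
  have "\<alpha> > 0" using pos by (simp add: \<alpha> add_pos_nonneg)
  \<comment> \<open>Dropping the mixed term of the square yields \<alpha> \<mu> \<le> \<alpha>1
    \<beta> \<eta>^2. The denominator in the lower bound for \<epsilon> is then positive, and so is
    \<epsilon>, as Young's inequality requires.\<close>
  have "?m\<^sup>2 + ?s\<^sup>2 \<le> (?m + ?s)\<^sup>2" using ms by (simp add: power2_sum)
  also have "\<dots> \<le> \<eta>\<^sup>2" using \<eta>ge ms by (intro power_mono) auto
  finally have "\<mu> / \<beta> + \<mu> * \<gamma>\<^sup>2 / \<alpha>1 \<le> \<eta>\<^sup>2" using pos by simp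
  then have "(\<alpha>1 * \<beta>) * (\<mu> / \<beta> + \<mu> * \<gamma>\<^sup>2 / \<alpha>1) \<le> (\<alpha>1 * \<beta>) * \<eta>\<^sup>2"
    using pos by (intro mult_left_mono) auto
  moreover have "(\<alpha>1 * \<beta>) * (\<mu> / \<beta> + \<mu> * \<gamma>\<^sup>2 / \<alpha>1) = \<alpha> * \<mu>"
    using pos by (simp add: \<alpha> field_simps)
  ultimately have "\<alpha> * \<mu> \<le> \<alpha>1 * \<beta> * \<eta>\<^sup>2" by simp
  moreover have "\<alpha> * \<mu> > 0" using \<open>\<alpha> > 0\<close> pos by simp
  ultimately have "4 * \<alpha>1 * \<beta> * \<eta>\<^sup>2 - \<alpha> * \<mu> > 0" by linarith
  then have "0 \<le> \<beta> * \<gamma>\<^sup>2 * \<mu> / (4 * \<alpha>1 * \<beta> * \<eta>\<^sup>2 - \<alpha> * \<mu>)" using pos by simp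
  then have "\<epsilon> > 0" using assms(8) by linarith
  \<comment> \<open>These bring c2m and c2p into the form (B -+ sqrt (B^2 - A C)) / A, where 2 B is
    the linear coefficient of the quadratic.\<close>
  define A where "A = \<epsilon> * \<alpha> + \<beta> * \<gamma>\<^sup>2"
  define B where "B = 2 * \<epsilon> * \<alpha>1 * \<beta> * \<eta>"
  define C where "C = \<epsilon> * \<mu> * \<alpha>1 * \<beta>"
  have "A > 0" using \<open>\<epsilon> > 0\<close> \<open>\<alpha> > 0\<close> pos by (simp add: A_def add_pos_nonneg)
  have "B \<ge> 0" "C \<ge> 0" using \<open>\<epsilon> > 0\<close> \<open>\<eta> > 0\<close> pos by (simp_all add: B_def C_def)
  have c1: "c1m = (2 * \<alpha>1 * \<eta> - sqrt ((2 * \<alpha>1 * \<eta>)\<^sup>2 - (1 + \<epsilon>) * (\<rho> * \<alpha>1))) / (1 + \<epsilon>)"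
    "c1p = (2 * \<alpha>1 * \<eta> + sqrt ((2 * \<alpha>1 * \<eta>)\<^sup>2 - (1 + \<epsilon>) * (\<rho> * \<alpha>1))) / (1 + \<epsilon>)"
    by (simp_all add: assms(10,11) power_mult_distrib mult.assoc)
  have c2: "c2m = (B - sqrt (B\<^sup>2 - A * C)) / A" "c2p = (B + sqrt (B\<^sup>2 - A * C)) / A"
    by (simp_all add: assms(12,13) A_def B_def C_def power_mult_distrib mult.assoc)
  have \<xi>: "c1m < \<xi>1" "\<xi>1 < c1p" "c2m < \<xi>2" "\<xi>2 < c2p" using assms(14,15) by auto
  have e1: "1 + \<epsilon> > 0" using \<open>\<epsilon> > 0\<close> by simp
  note Q1 = between_quadratic_roots[OF e1 \<xi>(1,2)[unfolded c1]]
  note Q2 = between_quadratic_roots[OF \<open>A > 0\<close> \<xi>(3,4)[unfolded c2]]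
  have nn1: "0 \<le> c1m" "0 \<le> c1p" unfolding c1
    using quadratic_roots_nonneg[OF e1 _ _ Q1(2)] pos \<open>\<eta> > 0\<close> by simp_all
  have nn2: "0 \<le> c2m" "0 \<le> c2p" unfolding c2
    using quadratic_roots_nonneg[OF \<open>A > 0\<close> \<open>B \<ge> 0\<close> \<open>C \<ge> 0\<close> Q2(2)] by simp_all
  have q1: "\<rho> + (1 + \<epsilon>) * \<xi>1\<^sup>2 / \<alpha>1 \<le> 4 * \<eta> * \<xi>1"
  proof -
    have "((1 + \<epsilon>) * \<xi>1\<^sup>2 + \<rho> * \<alpha>1) / \<alpha>1 \<le> 2 * (2 * \<alpha>1 * \<eta>) * \<xi>1 / \<alpha>1"
      using Q1(1) pos by (intro divide_right_mono) auto
    then show ?thesis using pos by (simp add: add_divide_distrib)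
  qed
  have q2: "\<mu> + ((1 + 1 / \<epsilon>) * \<gamma>\<^sup>2 / \<alpha>1 + 1 / \<beta>) * \<xi>2\<^sup>2 \<le> 4 * \<eta> * \<xi>2"
  proof -
    \<comment> \<open>Division by \<open>?k\<close> reduces C to \<mu> and 2 B to 4 \<eta>, and
      turns A into the coefficient produced by Young's inequality.\<close>
    let ?k = "\<epsilon> * \<alpha>1 * \<beta>"
    have k: "?k > 0" using pos \<open>\<epsilon> > 0\<close> by simp
    have "(A * \<xi>2\<^sup>2 + C) / ?k \<le> 2 * B * \<xi>2 / ?k"
      using Q2(1) k by (intro divide_right_mono) auto
    moreover have "A / ?k = (1 + 1 / \<epsilon>) * \<gamma>\<^sup>2 / \<alpha>1 + 1 / \<beta>"
      using pos \<open>\<epsilon> > 0\<close> by (simp add: A_def \<alpha> field_simps)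
    then have "(A * \<xi>2\<^sup>2 + C) / ?k = ((1 + 1 / \<epsilon>) * \<gamma>\<^sup>2 / \<alpha>1 + 1 / \<beta>) * \<xi>2\<^sup>2 + C / ?k"
      by (simp add: add_divide_distrib flip: times_divide_eq_left)
    moreover have "C / ?k = \<mu>" "2 * B * \<xi>2 / ?k = 4 * \<eta> * \<xi>2"
      using pos \<open>\<epsilon> > 0\<close> by (simp_all add: C_def B_def)
    ultimately show ?thesis by linarith
  qed
  have \<delta>: "\<delta> * L * \<eta> = 1 / 2" using pos \<open>\<eta> > 0\<close> by (simp add: assms(18))
  have M: "M = 3" by (simp add: assms(19) \<delta>)
  have "\<sigma> d \<le> \<sigma>max" for d
  proof -
    \<comment> \<open>The parabola \<sigma> in vertex form, with vertex at \<delta>.\<close>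
    have "0 \<le> (\<eta> * L) * (d - \<delta>)\<^sup>2" using pos \<open>\<eta> > 0\<close> by simp
    also have "\<dots> = \<sigma>max - \<sigma> d"
      using pos \<open>\<eta> > 0\<close> by (simp add: assms(16-18) power2_eq_square field_simps)
    finally show ?thesis by simp
  qed
  moreover have "\<sigma> \<delta> = \<sigma>max"
    using pos \<open>\<eta> > 0\<close> by (simp add: assms(16-18) field_simps)
  moreover have "energy L \<rho> \<mu> \<alpha>1 \<beta> \<gamma> (U t) \<le> M * energy L \<rho> \<mu> \<alpha>1 \<beta> \<gamma> (U 0) * exp (- \<sigma>max * t)"
    if "weak_solution L \<rho> \<mu> \<alpha>1 \<beta> \<gamma> \<xi>1 \<xi>2 U0 U" "t > 0" for U0 U t
    unfolding M assms(17)
    by (rule weak_solution_decay[OF pos(1) _ that])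
       (rule strong_solution_decay[OF pos \<open>\<epsilon> > 0\<close> \<eta> q1 q2])
  ultimately show ?thesis using nn1 nn2 M by blast
qed

end
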